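(* Consider problem $\min_{\mathbf x\in\mathbb R^n}F(\mathbf x)=\sum_{i=1}^I f_i(\mathbf x)$ where each $f_i$ is proper, closed and $L_i$-Lipschitz differentiable (possibly nonconvex) and $F$ is bounded from below. Let $\{(\mathbf x_i^k)_{i=1}^I\}_k$ be generated by ASY-SONATA (as in the context), where the step-size is obtained from a local sequence $\{\alpha^t\}_{t\in\mathbb N_0}$ with $\alpha^t\downarrow0$ and $\sum_t\alpha^t=\infty$ as follows: $\gamma^k=\alpha^{c_k}$, where $c_k$ is the number of iterations $t<k$ with $i^t=i^k$ (i.e., each agent draws successive elements of $\{\alpha^t\}$ according to its own activation count). For $\delta>0$ let $T_\delta$ be the first $k\in\mathbb N_0$ with $M_F(\mathbf x^k)\le\delta$. Then there is a constant $c>0$ such that $T_\delta\le\inf\{k\in\mathbb N_0:\sum_{t=0}^k\gamma^t\ge c/\delta\}$.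
   Context: Graph: $\mathcal G=(\mathcal V,\mathcal E)$, $\mathcal V=\{1,\dots,I\}$, strongly connected digraph without self-loops; $\mathcal N_i^{\rm in}=\{j:(j,i)\in\mathcal E\}$, $\mathcal N_i^{\rm out}=\{j:(i,j)\in\mathcal E\}$. Weight matrices $W=(w_{ij})$ (row-stochastic) and $A=(a_{ij})$ (column-stochastic) satisfy, for some $\bar m\in(0,1)$: diagonal entries $\ge\bar m$, entries $(i,j)$ with $(j,i)\in\mathcal E$ are $\ge\bar m$, all other entries $0$. Asynchrony model: $(i^k,\mathbf d^k)_{k\in\mathbb N_0}$, $i^k\in\mathcal V$, $\mathbf d^k=(d_j^k)_{j\in\mathcal N^{\rm in}_{i^k}}$, with every agent appearing among $i^k,\dots,i^{k+T-1}$ for all $k$ and $0\le d_j^k\le D$. ASY-SONATA: initialization $\mathbf x_i^0\in\mathbb R^n$, $\mathbf z_i^0=\nabla f_i(\mathbf x_i^0)$, $\tilde{\boldsymbol\rho}_{ij}^0=0$, $\tau_{ij}^{-1}=-D$, and $\boldsymbol\rho_{ij}^t=0$, $\mathbf v_i^t=0$ for $t=-D,\dots,0$. At iteration $k$ with $i=i^k$: (1) $\tau_{ij}^k=\max(\tau_{ij}^{k-1},k-d_j^k)$, $j\in\mathcal N_i^{\rm in}$; (2) $\mathbf v_i^{k+1}=\mathbf x_i^k-\gamma^k\mathbf z_i^k$; (3) $\mathbf x_i^{k+1}=w_{ii}\mathbf v_i^{k+1}+\sum_{j\in\mathcal N_i^{\rm in}}w_{ij}\mathbf v_j^{\tau_{ij}^k}$;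 (4) $\mathbf z_i^{k+1/2}=\mathbf z_i^k+\sum_{j\in\mathcal N_i^{\rm in}}(\boldsymbol\rho_{ij}^{\tau_{ij}^k}-\tilde{\boldsymbol\rho}_{ij}^k)+\nabla f_i(\mathbf x_i^{k+1})-\nabla f_i(\mathbf x_i^k)$; (5) $\mathbf z_i^{k+1}=a_{ii}\mathbf z_i^{k+1/2}$ and $\boldsymbol\rho_{ji}^{k+1}=\boldsymbol\rho_{ji}^k+a_{ji}\mathbf z_i^{k+1/2}$ for $j\in\mathcal N_i^{\rm out}$; (6) $\tilde{\boldsymbol\rho}_{ij}^{k+1}=\boldsymbol\rho_{ij}^{\tau_{ij}^k}$ for $j\in\mathcal N_i^{\rm in}$; (7) all other variables keep their values. Merit function: with $\mathbf x^k=[\mathbf x_1^{k\top},\dots,\mathbf x_I^{k\top}]^\top$ and $\bar{\mathbf x}^k=\frac1I\sum_i\mathbf x_i^k$, $M_F(\mathbf x^k)=\max\{\|\nabla F(\bar{\mathbf x}^k)\|^2,\|\mathbf x^k-\mathbf 1_I\otimes\bar{\mathbf x}^k\|^2\}$. *)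

theory Defs
  imports "HOL-Analysis.Analysis" "HOL-Library.Extended_Nat"
begin

text \<open>Agents are indexed by the set {..<I} (the paper uses {1,...,I}).\<close>

definition in_nbrs :: "nat set \<Rightarrow> (nat \<times> nat) set \<Rightarrow> nat \<Rightarrow> nat set" where
  "in_nbrs V E i = {j \<in> V. (j, i) \<in> E}"

definition out_nbrs :: "nat set \<Rightarrow> (nat \<times> nat) set \<Rightarrow> nat \<Rightarrow> nat set" where
  "out_nbrs V E i = {j \<in> V. (i, j) \<in> E}"

definition admissible_weights ::
  "nat set \<Rightarrow> (nat \<times> nat) set \<Rightarrow> real \<Rightarrow> (nat \<Rightarrow> nat \<Rightarrow> real) \<Rightarrow> bool" where
  "admissible_weights V E mbar M \<longleftrightarrow>
     (\<forall>i\<in>V. mbar \<le> M i i) \<and>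
     (\<forall>i\<in>V. \<forall>j\<in>V. (j, i) \<in> E \<longrightarrow> mbar \<le> M i j) \<and>
     (\<forall>i\<in>V. \<forall>j\<in>V. i \<noteq> j \<and> (j, i) \<notin> E \<longrightarrow> M i j = 0)"

definition row_stochastic :: "nat set \<Rightarrow> (nat \<Rightarrow> nat \<Rightarrow> real) \<Rightarrow> bool" where
  "row_stochastic V M \<longleftrightarrow> (\<forall>i\<in>V. (\<Sum>j\<in>V. M i j) = 1)"

definition column_stochastic :: "nat set \<Rightarrow> (nat \<Rightarrow> nat \<Rightarrow> real) \<Rightarrow> bool" where
  "column_stochastic V M \<longleftrightarrow> (\<forall>j\<in>V. (\<Sum>i\<in>V. M i j) = 1)"

definition activation_count :: "(nat \<Rightarrow> nat) \<Rightarrow> nat \<Rightarrow> nat" where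
  "activation_count ik k = card {t. t < k \<and> ik t = ik k}"

definition local_stepsize :: "(nat \<Rightarrow> real) \<Rightarrow> (nat \<Rightarrow> nat) \<Rightarrow> nat \<Rightarrow> real" where
  "local_stepsize \<alpha> ik k = \<alpha> (activation_count ik k)"

text \<open>Merit function M_F: the gradient of F = sum_i f_i is sum_i g_i; the squared norm of the
  stacked vector x - 1 (x) xbar is the sum of the squared norms of its blocks.\<close>
definition merit :: "nat \<Rightarrow> (nat \<Rightarrow> 'a::real_inner \<Rightarrow> 'a) \<Rightarrow> (nat \<Rightarrow> 'a) \<Rightarrow> real" where
  "merit I g xs =
     (let xb = (1 / real I) *\<^sub>R (\<Sum>i<I. xs i)
      in max ((norm (\<Sum>i<I. g i xb))\<^sup>2) (\<Sum>i<I. (norm (xs i - xb))\<^sup>2))"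

text \<open>First time k with P k (infinity if there is none).\<close>
definition first_time :: "(nat \<Rightarrow> bool) \<Rightarrow> enat" where
  "first_time P = Inf (enat ` {k. P k})"

end

theory Submission
  imports Defs
begin

text \<open>
  Eliminating \<open>v\<close>, the iterates \<open>x\<close> follow an averaging recursion with bounded delays, perturbed at
  iteration \<open>k\<close> by \<open>p\<^sub>k = - \<gamma>\<^sub>k z\<^sub>k\<close>. The response to a unit impulse converges geometrically to a
  common value bounded away from 0, so by superposition there is a point \<open>y\<^sub>k\<close> with
  \<open>y\<^sub>k\<^sub>+\<^sub>1 = y\<^sub>k + \<psi>\<^sub>k p\<^sub>k\<close>, \<open>\<psi>\<^sub>k \<ge> \<eta>\<close>, and \<open>x\<^sub>k - y\<^sub>k\<close> is a convolution of \<open>p\<close> with a summable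
  kernel. Dually, the share of a unit of gradient mass that reaches a given agent at time \<open>k\<close> solves
  a recursion of the same kind backwards in time, so \<open>z\<^sub>k\<close> is a multiple \<open>\<xi>\<^sub>k \<ge> \<eta>'\<close> of the sum of the
  local gradients up to a convolution of the gradient increments with a summable kernel.

  Hence every step is a descent step for \<open>F\<close> at \<open>y\<^sub>k\<close> up to errors whose squares are controlled by
  the squares of the \<open>p\<^sub>k\<close>. Since \<open>\<gamma>\<^sub>k \<rightarrow> 0\<close>, these errors are eventually absorbed, and
  \<open>\<Sum>\<^sub>k \<gamma>\<^sub>k M\<^sub>F(x\<^sub>k)\<close> is bounded. No comparison between the step sizes of different agents is needed.
\<close>

section \<open>Averaging with bounded delays\<close>

text \<open>The obstacle is a loop: steps cause disagreement, disagreement causes gradient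
  increments, these cause tracking errors, and tracking errors enter the next steps. The gains of
  the first three links depend on the network and the Lipschitz constants and need not be small.
  Only the last link carries the factor \<open>\<gamma>\<close>, so the loop closes once
  \<open>\<gamma>\<close> is small, whatever the gains are.

  The bookkeeping is in sums of squares: convolution with a summable kernel is bounded on
  square-summable sequences, and the square of a step of length \<open>\<gamma> G\<close> is at most
  \<open>\<gamma>\<close> times the decrease \<open>\<gamma> G^2\<close>. The errors thus cost a
  small fraction of the decrease, without square-summable step sizes.

  The point \<open>y\<close> weights each perturbation by its final influence, the limit of its
  impulse response, so \<open>y\<close> moves by the present perturbation alone, without delayed
  terms. As every \<open>z\<close> is close to a positive multiple of the full gradient, the step of
  any agent decreases \<open>F\<close> in proportion to its own step size; this is why uncoordinated
  step sizes do no harm.\<close>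

definition delayed_average ::
  "(nat \<Rightarrow> nat set) \<Rightarrow> (nat \<Rightarrow> nat \<Rightarrow> real) \<Rightarrow> (nat \<Rightarrow> nat) \<Rightarrow> (nat \<Rightarrow> nat \<Rightarrow> nat)
    \<Rightarrow> nat \<Rightarrow> (nat \<Rightarrow> nat \<Rightarrow> 'b::real_vector) \<Rightarrow> nat \<Rightarrow> 'b" where
  "delayed_average nb M act src n u j =
     (if j = act n then M j j *\<^sub>R u n j + (\<Sum>l\<in>nb j. M j l *\<^sub>R u (src n l) l) else u n j)"

text \<open>Delayed reads reach back a varying number of steps, so impulse responses are built by
  well-founded recursion.\<close>

lemma course_of_values_recursion:
  fixes F :: "nat \<Rightarrow> (nat \<Rightarrow> 'b) \<Rightarrow> 'b"
  assumes "\<And>k u u'. (\<And>t. t < k \<Longrightarrow> u t = u' t) \<Longrightarrow> F k u = F k u'"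
  shows "\<exists>u. \<forall>k. u k = F k u"
proof -
  have adm: "adm_wf less_than (\<lambda>u k. F k u)"
    unfolding adm_wf_def using assms by (metis less_than_iff)
  show ?thesis
    using wfrec_fixpoint[OF wf_less_than adm] by metis
qed

text \<open>With \<open>s\<close> the \<open>N\<close>-th root of \<open>r\<close>, the staircase
  lies below the geometric sequence \<open>s ^ n / r\<close>. Such kernels arise because contraction
  is proved once per block of iterations.\<close>

lemma summable_power_div:
  fixes r :: real
  assumes r: "0 < r" "r < 1" and N: "0 < N"
  shows "summable (\<lambda>n. r ^ (n div N))"
proof -
  define s where "s = root N r"
  have s: "0 < s" "s < 1" "s ^ N = r" using r N by (auto simp: s_def real_root_lt_1_iff)
  have "r ^ (n div N) \<le> (1 / r) * s ^ n" for n
  proof -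
    have "s ^ n = s ^ (N * (n div N) + n mod N)" by simp
    also have "\<dots> = r ^ (n div N) * s ^ (n mod N)" by (simp only: power_add power_mult s)
    finally have 1: "s ^ n = r ^ (n div N) * s ^ (n mod N)" .
    have "n mod N \<le> N" using N by (simp add: less_imp_le)
    then have "s ^ N \<le> s ^ (n mod N)" by (intro power_decreasing) (use s in auto)
    then have "r ^ (n div N) * r \<le> s ^ n" unfolding 1 s(3)[symmetric]
      by (intro mult_left_mono) (use r s in auto)
    then show ?thesis using r by (simp add: field_simps)
  qed
  then have "norm (r ^ (n div N)) \<le> (1 / r) * s ^ n" for n
    using r by (metis less_imp_le zero_le_power real_norm_def abs_of_nonneg)
  moreover have "summable (\<lambda>n. (1 / r) * s ^ n)"
    by (intro summable_mult summable_geometric) (use s in simp)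
  ultimately show ?thesis by (metis summable_comparison_test')
qed

locale averaging_graph =
  fixes V :: "nat set" and nb :: "nat \<Rightarrow> nat set" and M :: "nat \<Rightarrow> nat \<Rightarrow> real" and m :: real
  assumes finite_V: "finite V" and V_nonempty: "V \<noteq> {}"
    and m_pos: "0 < m" and m_less: "m < 1"
    and nb_V: "i \<in> V \<Longrightarrow> nb i \<subseteq> V"
    and M_diag: "i \<in> V \<Longrightarrow> m \<le> M i i"
    and M_nb: "i \<in> V \<Longrightarrow> j \<in> nb i \<Longrightarrow> m \<le> M i j"
    and M_sum: "i \<in> V \<Longrightarrow> M i i + (\<Sum>j\<in>nb i. M i j) = 1"
    and connected: "i \<in> V \<Longrightarrow> j \<in> V \<Longrightarrow> (i, j) \<in> {(a, b). b \<in> V \<and> a \<in> nb b}\<^sup>*"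
begin

text \<open>The estimates must be uniform in the horizon \<open>K\<close>, in \<open>act\<close> and in \<open>src\<close>: consensus uses them
  forwards in time for every horizon, gradient tracking uses them backwards from each time \<open>k\<close>.\<close>
definition schedule :: "nat \<Rightarrow> nat \<Rightarrow> nat \<Rightarrow> (nat \<Rightarrow> nat) \<Rightarrow> (nat \<Rightarrow> nat \<Rightarrow> nat) \<Rightarrow> bool" where
  "schedule T H K act src \<longleftrightarrow>
     (\<forall>n<K. act n \<in> V) \<and>
     (\<forall>n. n + T \<le> K \<longrightarrow> (\<forall>i\<in>V. \<exists>t. n \<le> t \<and> t < n + T \<and> act t = i)) \<and>
     (\<forall>n<K. \<forall>l\<in>nb (act n). src n l \<le> n \<and> n \<le> src n l + H)"

section \<open>Solutions of the delayed recursion: bounds and spreading along paths\<close>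

definition solves :: "nat \<Rightarrow> nat \<Rightarrow> (nat \<Rightarrow> nat) \<Rightarrow> (nat \<Rightarrow> nat \<Rightarrow> nat) \<Rightarrow> (nat \<Rightarrow> nat \<Rightarrow> real) \<Rightarrow> bool"
  where
  "solves K q act src u \<longleftrightarrow>
     (\<forall>n. q \<le> n \<and> n < K \<longrightarrow> (\<forall>j\<in>V. u (Suc n) j = delayed_average nb M act src n u j))"

definition impulse :: "nat \<Rightarrow> nat \<Rightarrow> (nat \<Rightarrow> nat \<Rightarrow> real) \<Rightarrow> bool" where
  "impulse q i u \<longleftrightarrow> (\<forall>n<q. \<forall>j\<in>V. u n j = 0) \<and> (\<forall>j\<in>V. u q j = (if j = i then 1 else 0))"

text \<open>Every row is a convex combination with entries at least \<open>m\<close>, so an excess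
  over the common bound \<open>a\<close> in a single argument survives with factor \<open>m\<close>.
  The first conclusion lets an agent keep its excess, the second passes it on from a
  neighbour.\<close>

lemma weighted_sum_ge:
  assumes i: "i \<in> V" and vi: "a + ei \<le> vi" "0 \<le> ei" and w: "\<And>l. l \<in> nb i \<Longrightarrow> a + e l \<le> w l"
    and e: "\<And>l. l \<in> nb i \<Longrightarrow> 0 \<le> e l"
  shows "a + m * ei \<le> M i i * vi + (\<Sum>l\<in>nb i. M i l * w l)"
    and "l0 \<in> nb i \<Longrightarrow> a + m * e l0 \<le> M i i * vi + (\<Sum>l\<in>nb i. M i l * w l)"
proof -
  have fin: "finite (nb i)" using nb_V[OF i] finite_V finite_subset by blast
  have Mi: "m \<le> M i i" "0 \<le> M i i" using M_diag[OF i] m_pos by auto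
  have Ml: "m \<le> M i l" "0 \<le> M i l" if "l \<in> nb i" for l using M_nb[OF i that] m_pos by auto
  have s: "(\<Sum>l\<in>nb i. M i l * (a + e l)) \<le> (\<Sum>l\<in>nb i. M i l * w l)"
    by (intro sum_mono mult_left_mono w Ml)
  have d: "M i i * (a + ei) \<le> M i i * vi" by (intro mult_left_mono vi Mi)
  have "(\<Sum>l\<in>nb i. M i l * (a + e l)) = (\<Sum>l\<in>nb i. M i l) * a + (\<Sum>l\<in>nb i. M i l * e l)"
    by (simp add: algebra_simps sum.distrib sum_distrib_left)
  moreover have "(\<Sum>l\<in>nb i. M i l) = 1 - M i i" using M_sum[OF i] by simp
  ultimately have eq: "M i i * (a + ei) + (\<Sum>l\<in>nb i. M i l * (a + e l))
      = a + M i i * ei + (\<Sum>l\<in>nb i. M i l * e l)"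
    by (simp add: algebra_simps)
  have pos: "0 \<le> (\<Sum>l\<in>nb i. M i l * e l)" by (intro sum_nonneg mult_nonneg_nonneg Ml e)
  have "m * ei \<le> M i i * ei" by (intro mult_right_mono Mi vi)
  then show "a + m * ei \<le> M i i * vi + (\<Sum>l\<in>nb i. M i l * w l)" using s d eq pos by linarith
  assume l0: "l0 \<in> nb i"
  have "M i l0 * e l0 \<le> (\<Sum>l\<in>nb i. M i l * e l)"
    by (rule member_le_sum[OF l0]) (auto simp: fin intro: mult_nonneg_nonneg Ml e)
  moreover have "m * e l0 \<le> M i l0 * e l0" by (intro mult_right_mono Ml e l0)
  moreover have "0 \<le> M i i * ei" using Mi vi by simp
  ultimately show "a + m * e l0 \<le> M i i * vi + (\<Sum>l\<in>nb i. M i l * w l)" using s d eq by linarith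
qed

text \<open>Delays are at most \<open>H\<close>, so the values at times from \<open>n0 - H\<close>
  to \<open>n0\<close> form the state of the recursion at \<open>n0\<close>, and convex combinations
  cannot leave a bound that holds on it.\<close>

lemma solution_ge:
  assumes sch: "schedule T H K act src" and sol: "solves K q act src u" and q: "q \<le> n0"
    and win: "\<And>t j. n0 \<le> t + H \<Longrightarrow> t \<le> n0 \<Longrightarrow> j \<in> V \<Longrightarrow> a \<le> u t j"
  shows "n0 \<le> t + H \<Longrightarrow> t \<le> K \<Longrightarrow> j \<in> V \<Longrightarrow> a \<le> u t j"
proof (induction t arbitrary: j rule: less_induct)
  case (less t)
  show ?case
  proof (cases "t \<le> n0")
    case True then show ?thesis using win less.prems by blast
  next
    case False
    then obtain n where t: "t = Suc n" and n: "n0 \<le> n" by (cases t) auto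
    have nK: "n < K" using less.prems t by simp
    have IH: "a \<le> u n j" using less.IH[of n] t n less.prems by simp
    have eq: "u t j = delayed_average nb M act src n u j"
      using sol q n nK less.prems unfolding solves_def t by auto
    show ?thesis
    proof (cases "j = act n")
      case True
      have "a + m * 0 \<le> M j j * u n j + (\<Sum>l\<in>nb j. M j l * u (src n l) l)"
      proof (rule weighted_sum_ge(1)[where e = "\<lambda>_. 0"])
        fix l assume l: "l \<in> nb j"
        then have "src n l \<le> n" "n \<le> src n l + H"
          using sch nK True unfolding schedule_def by auto
        moreover have "l \<in> V" using nb_V l less.prems by blast
        ultimately show "a + 0 \<le> u (src n l) l"
          using less.IH[of "src n l" l] t n less.prems by simp
      qed (use IH less.prems in auto)
      then show ?thesis using eq True by (simp add: delayed_average_def)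
    next
      case False then show ?thesis using eq IH by (simp add: delayed_average_def)
    qed
  qed
qed

lemma solves_uminus: "solves K q act src u \<Longrightarrow> solves K q act src (\<lambda>n j. - u n j)"
  by (auto simp: solves_def delayed_average_def sum_negf)

lemma solution_le:
  assumes "schedule T H K act src" and sol: "solves K q act src u" and "q \<le> n0"
    and win: "\<And>t j. n0 \<le> t + H \<Longrightarrow> t \<le> n0 \<Longrightarrow> j \<in> V \<Longrightarrow> u t j \<le> b"
    and "n0 \<le> t + H" "t \<le> K" "j \<in> V"
  shows "u t j \<le> b"
  using solution_ge[OF assms(1) solves_uminus[OF sol] assms(3), of "- b" t j] assms by simp

text \<open>Every hop is given \<open>H + T\<close> iterations: after the first \<open>H\<close>,
  all reads of the predecessor are recent enough to show its excess, and during the next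
  \<open>T\<close> the receiver is active. One factor \<open>m\<close> is charged per iteration,
  active or not, which makes the exponent \<open>t - n0\<close> independent of the path.\<close>

lemma spreading_along_path:
  assumes sch: "schedule T H K act src" and sol: "solves K q act src u" and q: "q \<le> n0"
    and win: "\<And>t j. n0 \<le> t + H \<Longrightarrow> t \<le> n0 \<Longrightarrow> j \<in> V \<Longrightarrow> a \<le> u t j"
    and i0: "i0 \<in> V" and e: "0 \<le> e" and u0: "a + e \<le> u n0 i0"
  shows "(i0, j) \<in> {(a, b). b \<in> V \<and> a \<in> nb b} ^^ p \<Longrightarrow> n0 + p * (H + T) \<le> t \<Longrightarrow> t \<le> K
    \<Longrightarrow> a + m ^ (t - n0) * e \<le> u t j"
proof (induction p arbitrary: j t)
  have keep: "a + m ^ (t - n0) * e \<le> u t j"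
    if j: "j \<in> V" and s: "n0 \<le> s" "a + m ^ (s - n0) * e \<le> u s j" and t: "s \<le> t" "t \<le> K" for s t j
    using t
  proof (induction t rule: dec_induct)
    case base then show ?case using s by simp
  next
    case (step n)
    have nK: "n < K" and n: "n0 \<le> n" using step s by auto
    have IH: "a + m ^ (n - n0) * e \<le> u n j" using step by simp
    have eq: "u (Suc n) j = delayed_average nb M act src n u j"
      using sol q n nK j unfolding solves_def by auto
    have pw: "m ^ (Suc n - n0) = m * m ^ (n - n0)" using n by (simp add: Suc_diff_le)
    have pos: "0 \<le> m ^ (n - n0) * e" using m_pos e by simp
    show ?case
    proof (cases "j = act n")
      case True
      have "a + m * (m ^ (n - n0) * e) \<le> M j j * u n j + (\<Sum>l\<in>nb j. M j l * u (src n l) l)"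
      proof (rule weighted_sum_ge(1)[where e = "\<lambda>_. 0", OF j IH pos])
        fix l assume l: "l \<in> nb j"
        then have "src n l \<le> n" "n \<le> src n l + H"
          using sch nK True unfolding schedule_def by auto
        moreover have "l \<in> V" using nb_V l j by blast
        ultimately show "a + 0 \<le> u (src n l) l"
          using solution_ge[OF sch sol q win, of "src n l" l] n nK by simp
      qed simp
      then show ?thesis using eq True pw by (simp add: delayed_average_def mult.assoc)
    next
      case False
      have "m * (m ^ (n - n0) * e) \<le> 1 * (m ^ (n - n0) * e)"
        by (intro mult_right_mono pos) (use m_less in simp)
      then show ?thesis using eq IH False pw by (simp add: delayed_average_def mult.assoc)
    qed
  qed
  {
    case 0
    then have "j = i0" "n0 \<le> t" by auto
    then show ?case using keep[of i0 n0 t] i0 u0 0 by simp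
  next
    case (Suc p)
    then obtain i where i: "(i0, i) \<in> {(a, b). b \<in> V \<and> a \<in> nb b} ^^ p" "j \<in> V" "i \<in> nb j" by auto
    define c where "c = n0 + p * (H + T)"
    have tc: "c + H + T \<le> t" using Suc.prems unfolding c_def by simp
    then have "c + H + T \<le> K" using Suc.prems by simp
    then obtain n where n: "c + H \<le> n" "n < c + H + T" "act n = j"
      using sch i(2) unfolding schedule_def by blast
    have nK: "n < K" using n tc Suc.prems by simp
    have qn: "n0 \<le> n" "n0 \<le> Suc n" using n c_def by auto
    have sb: "src n l \<le> n" "n \<le> src n l + H" if "l \<in> nb j" for l
      using sch nK n(3) that unfolding schedule_def by auto
    define s where "s = src n i"
    have s: "c \<le> s" "s \<le> n" using sb[OF i(3)] n unfolding s_def by auto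
    have us: "a + m ^ (s - n0) * e \<le> u s i" using Suc.IH[OF i(1), of s] s nK c_def by simp
    have eq: "u (Suc n) j = M j j * u n j + (\<Sum>l\<in>nb j. M j l * u (src n l) l)"
      using sol q qn nK i(2) n(3) unfolding solves_def by (auto simp: delayed_average_def)
    \<comment> \<open>Only the read of the predecessor \<open>i\<close> is credited with an excess;
      the other reads just satisfy the bound \<open>a\<close>.\<close>
    define ee where "ee = (\<lambda>l. if l = i then m ^ (s - n0) * e else 0)"
    have ge: "a \<le> u t l" if "n0 \<le> t + H" "t \<le> K" "l \<in> V" for t l
      using solution_ge[OF sch sol q win that] .
    have "a + m * ee i \<le> M j j * u n j + (\<Sum>l\<in>nb j. M j l * u (src n l) l)"
    proof (rule weighted_sum_ge(2)[where ei = 0, OF i(2) _ _ _ _ i(3)])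
      show "a + 0 \<le> u n j" using ge[of n j] qn nK i by simp
      fix l assume l: "l \<in> nb j"
      show "0 \<le> ee l" using m_pos e by (simp add: ee_def)
      have "l \<in> V" using nb_V l i(2) by blast
      then show "a + ee l \<le> u (src n l) l"
        using us ge[of "src n l" l] sb[OF l] qn nK by (auto simp: ee_def s_def)
    qed simp
    then have "a + m ^ Suc (s - n0) * e \<le> u (Suc n) j" using eq by (simp add: ee_def mult.assoc)
    moreover have "m ^ (Suc n - n0) * e \<le> m ^ Suc (s - n0) * e"
      by (intro mult_right_mono power_decreasing) (use m_pos m_less e s qn in auto)
    ultimately have "a + m ^ (Suc n - n0) * e \<le> u (Suc n) j" by linarith
    then show ?case using keep[OF i(2) qn(2)] n tc Suc.prems by simp
  }
qed

section \<open>Uniform spreading time and geometric decay of the oscillation\<close>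

lemma ex_path_bound: "\<exists>P. \<forall>i\<in>V. \<forall>j\<in>V. \<exists>p\<le>P. (i, j) \<in> {(a, b). b \<in> V \<and> a \<in> nb b} ^^ p"
proof -
  define R where "R = {(a, b). b \<in> V \<and> a \<in> nb b}"
  have "\<exists>p. ij \<in> R ^^ p" if "ij \<in> V \<times> V" for ij
    using that connected rtrancl_imp_relpow unfolding R_def[symmetric] by (cases ij) blast
  then obtain p where p: "\<And>ij. ij \<in> V \<times> V \<Longrightarrow> ij \<in> R ^^ p ij" by metis
  have "p (i, j) \<le> Max (p ` (V \<times> V))" if "i \<in> V" "j \<in> V" for i j
    using that finite_V by simp
  then show ?thesis unfolding R_def[symmetric] using p by blast
qed

text \<open>The longest path needed depends on the graph only, so one \<open>N\<close> serves all
  horizons, schedules, solutions and starting times; hence the position of the quantifiers.\<close>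

lemma ex_spreading_time:
  "\<exists>N. \<forall>K act src u q n0 a e i0. schedule T H K act src \<longrightarrow> solves K q act src u \<longrightarrow> q \<le> n0 \<longrightarrow>
     (\<forall>t. n0 \<le> t + H \<and> t \<le> n0 \<longrightarrow> (\<forall>j\<in>V. a \<le> u t j)) \<longrightarrow> i0 \<in> V \<longrightarrow> 0 \<le> e \<longrightarrow> a + e \<le> u n0 i0 \<longrightarrow>
     (\<forall>t. n0 + N \<le> t \<and> t \<le> K \<longrightarrow> (\<forall>j\<in>V. a + m ^ (t - n0) * e \<le> u t j))"
proof -
  obtain P where P: "\<forall>i\<in>V. \<forall>j\<in>V. \<exists>p\<le>P. (i, j) \<in> {(a, b). b \<in> V \<and> a \<in> nb b} ^^ p"
    using ex_path_bound by blast
  show ?thesis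
  proof (intro exI[of _ "P * (H + T)"] allI impI ballI, elim conjE)
    fix K act src u q n0 a e i0 t j
    assume h: "schedule T H K act src" "solves K q act src u" "q \<le> n0"
      "\<forall>t. n0 \<le> t + H \<and> t \<le> n0 \<longrightarrow> (\<forall>j\<in>V. a \<le> u t j)" "i0 \<in> V" "0 \<le> (e::real)" "a + e \<le> u n0 i0"
      and t: "n0 + P * (H + T) \<le> t" "t \<le> K" and j: "j \<in> V"
    obtain p where p: "p \<le> P" "(i0, j) \<in> {(a, b). b \<in> V \<and> a \<in> nb b} ^^ p" using P h j by blast
    have "n0 + p * (H + T) \<le> t" using p(1) t(1) mult_le_mono1[OF p(1), of "H + T"] by linarith
    then show "a + m ^ (t - n0) * e \<le> u t j"
      using spreading_along_path[OF h(1-3) _ h(5-7) p(2)] h(4) t by blast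
  qed
qed

text \<open>An arbitrary agent lies in the upper or in the lower half of the range. In the first
  case its excess over \<open>a\<close>, half the width, spreads to everybody and raises the lower
  bound; in the second case the same argument for \<open>- u\<close> lowers the upper bound. Waiting
  \<open>N + H\<close> rather than \<open>N\<close> iterations improves a whole window of length
  \<open>H\<close>, which is the next state.\<close>

lemma contraction_step:
  assumes N: "\<And>u a e i0 t j. solves K q act src u \<Longrightarrow>
     (\<And>t j. n0 \<le> t + H \<Longrightarrow> t \<le> n0 \<Longrightarrow> j \<in> V \<Longrightarrow> a \<le> u t j) \<Longrightarrow> i0 \<in> V \<Longrightarrow> 0 \<le> e \<Longrightarrow> a + e \<le> u n0 i0 \<Longrightarrow>
     n0 + N \<le> t \<Longrightarrow> t \<le> K \<Longrightarrow> j \<in> V \<Longrightarrow> a + m ^ (t - n0) * e \<le> u t j"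
    and sch: "schedule T H K act src" and sol: "solves K q act src u" and q: "q \<le> n0"
    and win: "\<forall>t. n0 \<le> t + H \<and> t \<le> n0 \<longrightarrow> (\<forall>j\<in>V. a \<le> u t j \<and> u t j \<le> b)"
    and K: "n0 + (N + H) \<le> K"
  shows "\<exists>a' b'. b' - a' = (1 - m ^ (N + H) / 2) * (b - a) \<and>
     (\<forall>t. n0 + (N + H) \<le> t + H \<and> t \<le> n0 + (N + H) \<longrightarrow> (\<forall>j\<in>V. a' \<le> u t j \<and> u t j \<le> b'))"
proof -
  obtain i0 where i0: "i0 \<in> V" using V_nonempty by blast
  have w1: "\<And>t j. n0 \<le> t + H \<Longrightarrow> t \<le> n0 \<Longrightarrow> j \<in> V \<Longrightarrow> a \<le> u t j"
    and w2: "\<And>t j. n0 \<le> t + H \<Longrightarrow> t \<le> n0 \<Longrightarrow> j \<in> V \<Longrightarrow> u t j \<le> b" using win by auto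
  have lo: "a \<le> u t j" and hi: "u t j \<le> b" if "n0 \<le> t + H" "t \<le> K" "j \<in> V" for t j
    using solution_ge[OF sch sol q w1 that] solution_le[OF sch sol q w2 that] by auto
  have ab: "a \<le> b" using lo[of n0 i0] hi[of n0 i0] i0 K by simp
  define e where "e = (b - a) / 2"
  have e: "0 \<le> e" using ab e_def by simp
  have dec: "m ^ (N + H) * e \<le> m ^ (t - n0) * e" if "t \<le> n0 + (N + H)" for t
    by (intro mult_right_mono power_decreasing e) (use m_pos m_less that in auto)
  show ?thesis
  proof (cases "a + e \<le> u n0 i0")
    case True
    have L: "a + m ^ (N + H) * e \<le> u t j"
      if "n0 + (N + H) \<le> t + H" "t \<le> n0 + (N + H)" "j \<in> V" for t j
      using N[OF sol w1 i0 e True, of t j] that K dec[OF that(2)] by simp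
    have U: "u t j \<le> b"
      if "n0 + (N + H) \<le> t + H" "t \<le> n0 + (N + H)" "j \<in> V" for t j
      using hi[of t j] that K by simp
    have "b - (a + m ^ (N + H) * e) = (1 - m ^ (N + H) / 2) * (b - a)"
      by (simp add: e_def field_simps)
    then show ?thesis using L U by blast
  next
    case False
    then have False': "- b + e \<le> - u n0 i0" unfolding e_def by (simp add: field_simps)
    have L: "- b + m ^ (N + H) * e \<le> - u t j"
      if "n0 + (N + H) \<le> t + H" "t \<le> n0 + (N + H)" "j \<in> V" for t j
      using N[OF solves_uminus[OF sol] _ i0 e False', of t j] w2 that K dec[OF that(2)] by simp
    have U: "u t j \<le> b - m ^ (N + H) * e" "a \<le> u t j"
      if "n0 + (N + H) \<le> t + H" "t \<le> n0 + (N + H)" "j \<in> V" for t j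
      using L[OF that] lo[of t j] that K by simp_all
    have "(b - m ^ (N + H) * e) - a = (1 - m ^ (N + H) / 2) * (b - a)"
      by (simp add: e_def field_simps)
    then show ?thesis using U by blast
  qed
qed

text \<open>The oscillation is at most 1 at the start and shrinks by a fixed factor over each block
  of \<open>N + H\<close> iterations. Comparing two different times costs nothing more, since both
  values stay in the range reached at the start of the earlier block.\<close>

theorem impulse_response:
  assumes H: "0 < H"
  obtains \<kappa> \<eta> N where "\<And>n. 0 \<le> \<kappa> n" and "summable \<kappa>" and "0 < \<eta>"
    and "\<And>K act src u q i n j. schedule T H K act src \<Longrightarrow> solves K q act src u \<Longrightarrow> impulse q i u \<Longrightarrow>
      i \<in> V \<Longrightarrow> n \<le> K \<Longrightarrow> j \<in> V \<Longrightarrow> 0 \<le> u n j \<and> u n j \<le> 1"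
    and "\<And>K act src u q i n j. schedule T H K act src \<Longrightarrow> solves K q act src u \<Longrightarrow> impulse q i u \<Longrightarrow>
      i \<in> V \<Longrightarrow> n \<le> K \<Longrightarrow> q + N \<le> n \<Longrightarrow> j \<in> V \<Longrightarrow> \<eta> \<le> u n j"
    and "\<And>K act src u q i n k j j'. schedule T H K act src \<Longrightarrow> solves K q act src u \<Longrightarrow> impulse q i u \<Longrightarrow>
      i \<in> V \<Longrightarrow> q \<le> n \<Longrightarrow> n \<le> k \<Longrightarrow> k \<le> K \<Longrightarrow> j \<in> V \<Longrightarrow> j' \<in> V \<Longrightarrow> \<bar>u k j' - u n j\<bar> \<le> \<kappa> (n - q)"
proof -
  obtain N where N0: "\<forall>K act src u q n0 a e i0. schedule T H K act src \<longrightarrow> solves K q act src u \<longrightarrow> q \<le> n0 \<longrightarrow>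
     (\<forall>t. n0 \<le> t + H \<and> t \<le> n0 \<longrightarrow> (\<forall>j\<in>V. a \<le> u t j)) \<longrightarrow> i0 \<in> V \<longrightarrow> 0 \<le> e \<longrightarrow> a + e \<le> u n0 i0 \<longrightarrow>
     (\<forall>t. n0 + N \<le> t \<and> t \<le> K \<longrightarrow> (\<forall>j\<in>V. a + m ^ (t - n0) * e \<le> u t j))"
    using ex_spreading_time by blast
  have N: "a + m ^ (t - n0) * e \<le> u t j"
    if "schedule T H K act src" "solves K q act src u" "q \<le> n0"
      and "\<And>t j. n0 \<le> t + H \<Longrightarrow> t \<le> n0 \<Longrightarrow> j \<in> V \<Longrightarrow> a \<le> u t j"
      and "i0 \<in> V" "0 \<le> e" "a + e \<le> u n0 i0" "n0 + N \<le> t" "t \<le> K" "j \<in> V"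
    for K act src u q n0 a e i0 t j
    using N0[rule_format, OF that(1-3) _ that(5-7), of t j] that(4,8-10) by blast
  define \<eta> where "\<eta> = m ^ (N + H)"
  define r where "r = 1 - \<eta> / 2"
  have \<eta>: "0 < \<eta>" "\<eta> < 1" using m_pos m_less H by (auto simp: \<eta>_def power_Suc_less_one intro: power_less_one_iff[THEN iffD2])
  have r: "0 < r" "r < 1" using \<eta> unfolding r_def by auto
  define \<kappa> where "\<kappa> n = r ^ (n div (N + H))" for n
  have main: "(\<forall>n\<le>K. \<forall>j\<in>V. 0 \<le> u n j \<and> u n j \<le> 1) \<and>
      (\<forall>n\<le>K. q + (N + H) \<le> n \<longrightarrow> (\<forall>j\<in>V. \<eta> \<le> u n j)) \<and>
      (\<forall>n k. q \<le> n \<and> n \<le> k \<and> k \<le> K \<longrightarrow> (\<forall>j\<in>V. \<forall>j'\<in>V. \<bar>u k j' - u n j\<bar> \<le> \<kappa> (n - q)))"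
    if sch: "schedule T H K act src" and sol: "solves K q act src u"
      and imp: "impulse q i u" and i: "i \<in> V" for K act src u q i
  proof -
    have init: "0 \<le> u t j \<and> u t j \<le> 1" if "t \<le> q" "j \<in> V" for t j
      using imp that unfolding impulse_def by (cases "t < q") auto
    have ge: "a \<le> u t j"
      if "q \<le> n0" "\<forall>t. n0 \<le> t + H \<and> t \<le> n0 \<longrightarrow> (\<forall>j\<in>V. a \<le> u t j)" "n0 \<le> t + H" "t \<le> K" "j \<in> V"
      for a n0 t j using solution_ge[OF sch sol that(1) _ that(3-5), of a] that(2) by blast
    have le: "u t j \<le> b"
      if "q \<le> n0" "\<forall>t. n0 \<le> t + H \<and> t \<le> n0 \<longrightarrow> (\<forall>j\<in>V. u t j \<le> b)" "n0 \<le> t + H" "t \<le> K" "j \<in> V"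
      for b n0 t j using solution_le[OF sch sol that(1) _ that(3-5), of b] that(2) by blast
    have bounds: "0 \<le> u n j \<and> u n j \<le> 1" if "n \<le> K" "j \<in> V" for n j
    proof (cases "n \<le> q")
      case True then show ?thesis using init that by blast
    next
      case False
      then show ?thesis using ge[of q 0 n j] le[of q 1 n j] init that by simp
    qed
    \<comment> \<open>The unit at \<open>i\<close> is an excess 1 over the bound 0. It fills a whole
      window within \<open>N + H\<close> iterations, and from there the bound \<open>\<eta>\<close>
      persists.\<close>
    have lower: "\<eta> \<le> u n j" if n: "n \<le> K" "q + (N + H) \<le> n" and j: "j \<in> V" for n j
    proof (rule ge[of "q + (N + H)"])
      have "0 + m ^ (t - q) * 1 \<le> u t j" if "q + N \<le> t" "t \<le> K" "j \<in> V" for t j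
        by (rule N[OF sch sol order_refl _ i _ _ that])
          (use init i imp in \<open>auto simp: impulse_def\<close>)
      then have *: "m ^ (t - q) \<le> u t j" if "q + N \<le> t" "t \<le> K" "j \<in> V" for t j
        using that by simp
      have **: "\<eta> \<le> m ^ (t - q)" if "t \<le> q + (N + H)" for t
        unfolding \<eta>_def by (intro power_decreasing) (use m_pos m_less that in auto)
      show "\<forall>t. q + (N + H) \<le> t + H \<and> t \<le> q + (N + H) \<longrightarrow> (\<forall>j\<in>V. \<eta> \<le> u t j)"
      proof (intro allI impI ballI)
        fix t j assume t: "q + (N + H) \<le> t + H \<and> t \<le> q + (N + H)" and j: "j \<in> V"
        then have "t \<le> K" using n by linarith
        then show "\<eta> \<le> u t j" using *[of t j] **[of t] t j by simp
      qed
    qed (use n j in auto)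
    have iter: "\<exists>a b. b - a = r ^ p \<and>
      (\<forall>t. q + p * (N + H) \<le> t + H \<and> t \<le> q + p * (N + H) \<longrightarrow> (\<forall>j\<in>V. a \<le> u t j \<and> u t j \<le> b))"
      if "q + p * (N + H) \<le> K" for p
      using that
    proof (induction p)
      case 0
      show ?case by (rule exI[of _ 0], rule exI[of _ 1]) (use init in auto)
    next
      case (Suc p)
      then obtain a b where ab: "b - a = r ^ p"
        "\<forall>t. q + p * (N + H) \<le> t + H \<and> t \<le> q + p * (N + H) \<longrightarrow> (\<forall>j\<in>V. a \<le> u t j \<and> u t j \<le> b)"
        by auto
      have s: "q + p * (N + H) + (N + H) = q + Suc p * (N + H)" by simp
      have "\<exists>a' b'. b' - a' = (1 - m ^ (N + H) / 2) * (b - a) \<and>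
        (\<forall>t. q + p * (N + H) + (N + H) \<le> t + H \<and> t \<le> q + p * (N + H) + (N + H) \<longrightarrow>
          (\<forall>j\<in>V. a' \<le> u t j \<and> u t j \<le> b'))"
      proof (rule contraction_step[OF _ sch sol _ ab(2)])
        show "q + p * (N + H) + (N + H) \<le> K" using Suc.prems by simp
      qed (rule N[OF sch], assumption+, simp_all)
      then show ?case unfolding s ab(1) by (simp add: r_def \<eta>_def)
    qed
    have spread: "\<bar>u k j' - u n j\<bar> \<le> \<kappa> (n - q)"
      if n: "q \<le> n" "n \<le> k" "k \<le> K" and j: "j \<in> V" "j' \<in> V" for n k j j'
    proof -
      define p where "p = (n - q) div (N + H)"
      have "p * (N + H) \<le> n - q" unfolding p_def by (rule div_times_less_eq_dividend)
      then have p: "q + p * (N + H) \<le> n" using n by simp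
      then obtain a b where ab: "b - a = r ^ p"
        "\<forall>t. q + p * (N + H) \<le> t + H \<and> t \<le> q + p * (N + H) \<longrightarrow> (\<forall>j\<in>V. a \<le> u t j \<and> u t j \<le> b)"
        using iter[of p] n by auto
      have "a \<le> u k j'" "u k j' \<le> b" "a \<le> u n j" "u n j \<le> b"
        using ge[OF _ _ _ _ j(2), of "q + p * (N + H)" a k] le[OF _ _ _ _ j(2), of "q + p * (N + H)" b k]
          ge[OF _ _ _ _ j(1), of "q + p * (N + H)" a n] le[OF _ _ _ _ j(1), of "q + p * (N + H)" b n] ab(2) p n
        by auto
      then show ?thesis using ab(1) unfolding \<kappa>_def p_def by linarith
    qed
    show "(\<forall>n\<le>K. \<forall>j\<in>V. 0 \<le> u n j \<and> u n j \<le> 1) \<and>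
      (\<forall>n\<le>K. q + (N + H) \<le> n \<longrightarrow> (\<forall>j\<in>V. \<eta> \<le> u n j)) \<and>
      (\<forall>n k. q \<le> n \<and> n \<le> k \<and> k \<le> K \<longrightarrow> (\<forall>j\<in>V. \<forall>j'\<in>V. \<bar>u k j' - u n j\<bar> \<le> \<kappa> (n - q)))"
      using bounds lower spread by blast
  qed
  show thesis
  proof (rule that[of \<kappa> \<eta> "N + H"])
    show "0 \<le> \<kappa> n" for n using r by (simp add: \<kappa>_def)
    show "summable \<kappa>" unfolding \<kappa>_def by (rule summable_power_div) (use r H in auto)
  qed (use \<eta> main in blast)+
qed

section \<open>Superposition of impulse responses\<close>

lemma ex_impulse_solution:
  "\<exists>u. impulse q i u \<and>
     (\<forall>K. (\<forall>n<K. \<forall>l\<in>nb (act n). src n l \<le> n) \<longrightarrow> solves K q act src u)"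
proof -
  \<comment> \<open>\<open>min n\<close> makes the recursion look backwards for arbitrary
    \<open>src\<close> and disappears wherever \<open>src n l \<le> n\<close>; thus a single
    \<open>u\<close> serves every horizon.\<close>
  define F where "F k u = (\<lambda>j. if k < q then 0 else if k = q then (if j = i then 1 else 0)
      else delayed_average nb M act (\<lambda>n l. min n (src n l)) (k - 1) u j)"
    for k and u :: "nat \<Rightarrow> nat \<Rightarrow> real"
  have "\<exists>u. \<forall>k. u k = F k u"
    by (rule course_of_values_recursion) (auto simp: F_def delayed_average_def fun_eq_iff)
  then obtain u where u: "\<And>k. u k = F k u" by blast
  have "impulse q i u" unfolding impulse_def by (subst u, simp add: F_def) (subst u, simp add: F_def)
  moreover have "solves K q act src u" if "\<forall>n<K. \<forall>l\<in>nb (act n). src n l \<le> n" for K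
    unfolding solves_def
  proof (intro allI impI ballI)
    fix n j assume n: "q \<le> n \<and> n < K" and "j \<in> V"
    have "u (Suc n) j = delayed_average nb M act (\<lambda>n l. min n (src n l)) n u j"
      using n by (subst u) (simp add: F_def)
    also have "\<dots> = delayed_average nb M act src n u j"
      using that n by (auto simp: delayed_average_def min_absorb2 intro!: sum.cong)
    finally show "u (Suc n) j = delayed_average nb M act src n u j" .
  qed
  ultimately show ?thesis by blast
qed

text \<open>Discrete variation of constants: the recursion is linear and starts from 0, so the
  inputs propagate separately. The input of iteration \<open>s\<close> first shows at time
  \<open>s + 1\<close>, where its impulse starts.\<close>

lemma superposition:
  fixes X :: "nat \<Rightarrow> nat \<Rightarrow> 'b::real_vector"
  assumes act: "\<And>n. act n \<in> V" and src: "\<And>n l. l \<in> nb (act n) \<Longrightarrow> src n l \<le> n"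
    and imp: "\<And>s i. impulse (Suc s) i (\<Psi> s i)" and sol: "\<And>s i K. solves K (Suc s) act src (\<Psi> s i)"
    and X0: "\<And>j. j \<in> V \<Longrightarrow> X 0 j = 0"
    and X_Suc: "\<And>n j. j \<in> V \<Longrightarrow> X (Suc n) j = delayed_average nb M act src n X j + inp n j"
  shows "j \<in> V \<Longrightarrow> X n j = (\<Sum>s<n. \<Sum>i\<in>V. \<Psi> s i n j *\<^sub>R inp s i)"
proof (induction n arbitrary: j rule: less_induct)
  case (less n)
  show ?case
  proof (cases n)
    case 0 then show ?thesis using X0 less.prems by simp
  next
    case (Suc n')
    \<comment> \<open>Impulses vanish before they start, so all times up to \<open>n'\<close> can
      share the index set \<open>s < n'\<close>, and delayed reads combine term by term.\<close>
    have ext: "X k l = (\<Sum>s<n'. \<Sum>i\<in>V. \<Psi> s i k l *\<^sub>R inp s i)" if "k \<le> n'" "l \<in> V" for k l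
    proof -
      have "X k l = (\<Sum>s<k. \<Sum>i\<in>V. \<Psi> s i k l *\<^sub>R inp s i)" using less.IH[of k l] that Suc by simp
      also have "\<dots> = (\<Sum>s<n'. \<Sum>i\<in>V. \<Psi> s i k l *\<^sub>R inp s i)"
        by (rule sum.mono_neutral_left) (use that imp in \<open>auto simp: impulse_def not_less intro!: sum.neutral\<close>)
      finally show ?thesis .
    qed
    have "(\<Sum>s<n'. \<Sum>i\<in>V. \<Psi> s i (Suc n') j *\<^sub>R inp s i)
        = (\<Sum>s<n'. \<Sum>i\<in>V. delayed_average nb M act src n' (\<Psi> s i) j *\<^sub>R inp s i)"
    proof (intro sum.cong refl)
      fix s i assume "s \<in> {..<n'}" "i \<in> V"
      then show "\<Psi> s i (Suc n') j *\<^sub>R inp s i = delayed_average nb M act src n' (\<Psi> s i) j *\<^sub>R inp s i"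
        using sol[of "Suc n'" s i] less.prems unfolding solves_def by simp
    qed
    also have "\<dots> = delayed_average nb M act src n' X j"
    proof (cases "j = act n'")
      case False
      then show ?thesis using ext[of n' j] less.prems by (simp add: delayed_average_def)
    next
      case True
      have eq: "X (src n' l) l = (\<Sum>s<n'. \<Sum>i\<in>V. \<Psi> s i (src n' l) l *\<^sub>R inp s i)" if "l \<in> nb j" for l
        using ext[of "src n' l" l] src[of l n'] that nb_V less.prems True by blast
      have "(\<Sum>l\<in>nb j. M j l *\<^sub>R X (src n' l) l)
          = (\<Sum>l\<in>nb j. \<Sum>s<n'. \<Sum>i\<in>V. (M j l * \<Psi> s i (src n' l) l) *\<^sub>R inp s i)"
        by (intro sum.cong refl) (simp add: eq scaleR_sum_right)
      also have "\<dots> = (\<Sum>s<n'. \<Sum>i\<in>V. \<Sum>l\<in>nb j. (M j l * \<Psi> s i (src n' l) l) *\<^sub>R inp s i)"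
        by (subst sum.swap) (intro sum.cong refl sum.swap)
      finally show ?thesis using True ext[of n' j] less.prems
        by (simp add: delayed_average_def scaleR_add_left scaleR_sum_left scaleR_sum_right sum.distrib)
    qed
    finally have 1: "(\<Sum>s<n'. \<Sum>i\<in>V. \<Psi> s i (Suc n') j *\<^sub>R inp s i) = delayed_average nb M act src n' X j" .
    have "(\<Sum>i\<in>V. \<Psi> n' i (Suc n') j *\<^sub>R inp n' i) = (\<Sum>i\<in>V. if i = j then inp n' i else 0)"
      using imp less.prems by (intro sum.cong refl) (auto simp: impulse_def)
    then have 2: "(\<Sum>i\<in>V. \<Psi> n' i (Suc n') j *\<^sub>R inp n' i) = inp n' j"
      using less.prems finite_V by simp
    show ?thesis unfolding Suc using X_Suc[OF less.prems, of n'] 1 2 by simp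
  qed
qed

text \<open>\<open>\<psi> s i\<close> is the value on which all agents finally agree after a unit
  input at \<open>i\<close> in iteration \<open>s\<close>. The newest input is subtracted
  separately, as it sits at one agent and has not been averaged yet.\<close>

theorem perturbed_consensus:
  fixes X :: "nat \<Rightarrow> nat \<Rightarrow> 'b::real_normed_vector"
  assumes H: "0 < H" and sch: "\<And>K. schedule T H K act src"
    and X0: "\<And>j. j \<in> V \<Longrightarrow> X 0 j = 0"
    and X_Suc: "\<And>n j. j \<in> V \<Longrightarrow> X (Suc n) j = delayed_average nb M act src n X j + inp n j"
  shows "\<exists>\<kappa> \<eta> \<psi>. (\<forall>n. 0 \<le> \<kappa> n) \<and> summable \<kappa> \<and> 0 < \<eta> \<and>
    (\<forall>s. \<forall>i\<in>V. \<eta> \<le> \<psi> s i \<and> \<psi> s i \<le> 1) \<and>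
    (\<forall>n. \<forall>j\<in>V. norm (X (Suc n) j - inp n j - (\<Sum>s<n. \<Sum>i\<in>V. \<psi> s i *\<^sub>R inp s i))
       \<le> (\<Sum>s<n. \<kappa> (n - s) * (\<Sum>i\<in>V. norm (inp s i))))"
proof (rule impulse_response[OF H, of T])
  fix \<kappa> :: "nat \<Rightarrow> real" and \<eta> :: real and N :: nat
  assume \<kappa>: "\<And>n. 0 \<le> \<kappa> n" "summable \<kappa>" and \<eta>: "0 < \<eta>"
    and B: "\<And>K act src u q i n j. schedule T H K act src \<Longrightarrow> solves K q act src u \<Longrightarrow> impulse q i u \<Longrightarrow>
      i \<in> V \<Longrightarrow> n \<le> K \<Longrightarrow> j \<in> V \<Longrightarrow> 0 \<le> u n j \<and> u n j \<le> 1"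
    and P: "\<And>K act src u q i n j. schedule T H K act src \<Longrightarrow> solves K q act src u \<Longrightarrow> impulse q i u \<Longrightarrow>
      i \<in> V \<Longrightarrow> n \<le> K \<Longrightarrow> q + N \<le> n \<Longrightarrow> j \<in> V \<Longrightarrow> \<eta> \<le> u n j"
    and C: "\<And>K act src u q i n k j j'. schedule T H K act src \<Longrightarrow> solves K q act src u \<Longrightarrow> impulse q i u \<Longrightarrow>
      i \<in> V \<Longrightarrow> q \<le> n \<Longrightarrow> n \<le> k \<Longrightarrow> k \<le> K \<Longrightarrow> j \<in> V \<Longrightarrow> j' \<in> V \<Longrightarrow> \<bar>u k j' - u n j\<bar> \<le> \<kappa> (n - q)"
  have act: "act n \<in> V" for n using sch[of "Suc n"] unfolding schedule_def by blast
  have src: "src n l \<le> n" if "l \<in> nb (act n)" for n l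
    using sch[of "Suc n"] that unfolding schedule_def by blast
  have "\<exists>u. impulse (Suc s) i u \<and> (\<forall>K. solves K (Suc s) act src u)" for s i
    using ex_impulse_solution[of "Suc s" i act src] src by blast
  then obtain \<Psi> where imp: "\<And>s i. impulse (Suc s) i (\<Psi> s i)"
    and sol: "\<And>s i K. solves K (Suc s) act src (\<Psi> s i)" by metis
  have le1: "\<Psi> s i n j \<le> 1" if "i \<in> V" "j \<in> V" for s i n j
    using B[OF sch sol imp that(1) order_refl that(2)] by blast
  have ge: "\<eta> \<le> \<Psi> s i n j" if "i \<in> V" "j \<in> V" "Suc s + N \<le> n" for s i n j
    by (rule P[OF sch sol imp that(1) order_refl that(3,2)])
  have spread: "\<bar>\<Psi> s i k j' - \<Psi> s i n j\<bar> \<le> \<kappa> (n - Suc s)"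
    if "i \<in> V" "j \<in> V" "j' \<in> V" "Suc s \<le> n" "n \<le> k" for s i n j j' k
    by (rule C[OF sch sol imp that(1,4,5) order_refl that(2,3)])
  obtain j0 where j0: "j0 \<in> V" using V_nonempty by blast
  have "\<exists>L. (\<lambda>k. \<Psi> s i k j0) \<longlonglongrightarrow> L" if i: "i \<in> V" for s i
  proof -
    have "Cauchy (\<lambda>k. \<Psi> s i k j0)"
    proof (rule metric_CauchyI)
      fix e :: real assume e: "0 < e"
      have "\<kappa> \<longlonglongrightarrow> 0" using \<kappa>(2) by (rule summable_LIMSEQ_zero)
      then have "eventually (\<lambda>n. \<kappa> n < e / 2) sequentially"
        using e by (intro order_tendstoD(2)) auto
      then obtain n0 where n0: "\<And>n. n \<ge> n0 \<Longrightarrow> \<kappa> n < e / 2"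
        unfolding eventually_sequentially by blast
      have b: "\<bar>\<Psi> s i k j0 - \<Psi> s i (Suc s + n0) j0\<bar> < e / 2" if "k \<ge> Suc s + n0" for k
        using spread[OF i j0 j0, of s "Suc s + n0" k] that n0[of n0] by simp
      have "dist (\<Psi> s i k j0) (\<Psi> s i k' j0) < e" if "k \<ge> Suc s + n0" "k' \<ge> Suc s + n0" for k k'
        using b[OF that(1)] b[OF that(2)] unfolding dist_real_def by linarith
      then show "\<exists>M. \<forall>m\<ge>M. \<forall>n\<ge>M. dist (\<Psi> s i m j0) (\<Psi> s i n j0) < e" by blast
    qed
    then show ?thesis using Cauchy_convergent_iff convergent_def by blast
  qed
  then obtain \<psi> where \<psi>: "\<And>s i. i \<in> V \<Longrightarrow> (\<lambda>k. \<Psi> s i k j0) \<longlonglongrightarrow> \<psi> s i" by metis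
  have \<psi>1: "\<eta> \<le> \<psi> s i \<and> \<psi> s i \<le> 1" if i: "i \<in> V" for s i
    using LIMSEQ_le_const[OF \<psi>[OF i], of \<eta> s] LIMSEQ_le_const2[OF \<psi>[OF i], of s 1] ge[OF i j0, of s] le1[OF i j0] by blast
  have \<psi>2: "\<bar>\<Psi> s i n j - \<psi> s i\<bar> \<le> \<kappa> (n - Suc s)" if i: "i \<in> V" and j: "j \<in> V" and n: "Suc s \<le> n" for s i n j
  proof -
    have "(\<lambda>k. \<bar>\<Psi> s i n j - \<Psi> s i k j0\<bar>) \<longlonglongrightarrow> \<bar>\<Psi> s i n j - \<psi> s i\<bar>"
      by (intro tendsto_intros \<psi> i)
    moreover have "\<forall>k\<ge>n. \<bar>\<Psi> s i n j - \<Psi> s i k j0\<bar> \<le> \<kappa> (n - Suc s)"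
      using spread[OF i j j0 n] by (simp add: abs_minus_commute)
    ultimately show ?thesis using LIMSEQ_le_const2 by blast
  qed
  have "norm (X (Suc n) j - inp n j - (\<Sum>s<n. \<Sum>i\<in>V. \<psi> s i *\<^sub>R inp s i))
       \<le> (\<Sum>s<n. \<kappa> (n - s) * (\<Sum>i\<in>V. norm (inp s i)))" if j: "j \<in> V" for n j
  proof -
    have "(\<Sum>i\<in>V. \<Psi> n i (Suc n) j *\<^sub>R inp n i) = (\<Sum>i\<in>V. if i = j then inp n i else 0)"
      using imp j by (intro sum.cong refl) (auto simp: impulse_def)
    then have last: "(\<Sum>i\<in>V. \<Psi> n i (Suc n) j *\<^sub>R inp n i) = inp n j" using j finite_V by simp
    have "X (Suc n) j = (\<Sum>s<Suc n. \<Sum>i\<in>V. \<Psi> s i (Suc n) j *\<^sub>R inp s i)"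
      by (rule superposition[OF act src imp sol X0 X_Suc j])
    then have "X (Suc n) j - inp n j - (\<Sum>s<n. \<Sum>i\<in>V. \<psi> s i *\<^sub>R inp s i)
      = (\<Sum>s<n. \<Sum>i\<in>V. (\<Psi> s i (Suc n) j - \<psi> s i) *\<^sub>R inp s i)"
      using last by (simp add: scaleR_diff_left sum_subtractf)
    also have "norm \<dots> \<le> (\<Sum>s<n. \<Sum>i\<in>V. \<kappa> (n - s) * norm (inp s i))"
    proof (intro sum_norm_le)
      fix s i assume "s \<in> {..<n}" "i \<in> V"
      then show "norm ((\<Psi> s i (Suc n) j - \<psi> s i) *\<^sub>R inp s i) \<le> \<kappa> (n - s) * norm (inp s i)"
        using \<psi>2[of i j s "Suc n"] j by (simp add: mult_right_mono)
    qed
    finally show ?thesis by (simp add: sum_distrib_left)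
  qed
  then show ?thesis using \<kappa> \<eta> \<psi>1 by blast
qed

end

section \<open>A small-gain estimate\<close>

text \<open>Young's inequality for convolutions: split \<open>\<kappa>\<close> into two square
  roots, apply Cauchy-Schwarz and exchange the sums; rows and columns of the kernel sum to at most
  \<open>suminf \<kappa>\<close>.\<close>

lemma sum_convolution_square_le:
  fixes \<kappa> e :: "nat \<Rightarrow> real"
  assumes \<kappa>: "\<And>n. 0 \<le> \<kappa> n" "summable \<kappa>"
  shows "(\<Sum>k\<le>n. (\<Sum>s<k. \<kappa> (k - s) * e s)\<^sup>2) \<le> (suminf \<kappa>)\<^sup>2 * (\<Sum>s<n. (e s)\<^sup>2)"
proof -
  define S where "S = suminf \<kappa>"
  have S0: "0 \<le> S" unfolding S_def using \<kappa> by (simp add: suminf_nonneg)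
  have fin: "sum \<kappa> A \<le> S" if "finite A" for A
    unfolding S_def using \<kappa> that by (simp add: sum_le_suminf)
  have reidx1: "(\<Sum>s<k. \<kappa> (k - s)) \<le> S" for k
  proof -
    have "(\<Sum>s<k. \<kappa> (k - s)) = sum \<kappa> ((\<lambda>s. k - s) ` {..<k})"
      by (subst sum.reindex) (auto simp: inj_on_def)
    then show ?thesis using fin by simp
  qed
  have reidx2: "(\<Sum>k\<in>{s<..n}. \<kappa> (k - s)) \<le> S" for s
  proof -
    have "(\<Sum>k\<in>{s<..n}. \<kappa> (k - s)) = sum \<kappa> ((\<lambda>k. k - s) ` {s<..n})"
      by (subst sum.reindex) (auto simp: inj_on_def)
    then show ?thesis using fin by simp
  qed
  have cs: "(\<Sum>s<k. \<kappa> (k - s) * e s)\<^sup>2 \<le> S * (\<Sum>s<k. \<kappa> (k - s) * (e s)\<^sup>2)" for k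
  proof -
    have "(\<Sum>s<k. \<kappa> (k - s) * e s)\<^sup>2 = (\<Sum>s<k. sqrt (\<kappa> (k - s)) * (sqrt (\<kappa> (k - s)) * e s))\<^sup>2"
      using \<kappa>(1) by (simp add: mult.assoc[symmetric])
    also have "\<dots> \<le> (\<Sum>s<k. (sqrt (\<kappa> (k - s)))\<^sup>2) * (\<Sum>s<k. (sqrt (\<kappa> (k - s)) * e s)\<^sup>2)"
      by (rule Cauchy_Schwarz_ineq_sum)
    also have "\<dots> = (\<Sum>s<k. \<kappa> (k - s)) * (\<Sum>s<k. \<kappa> (k - s) * (e s)\<^sup>2)"
      using \<kappa>(1) by (simp add: power_mult_distrib)
    also have "\<dots> \<le> S * (\<Sum>s<k. \<kappa> (k - s) * (e s)\<^sup>2)"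
      by (intro mult_right_mono reidx1 sum_nonneg) (simp add: \<kappa>)
    finally show ?thesis .
  qed
  have "(\<Sum>k\<le>n. (\<Sum>s<k. \<kappa> (k - s) * e s)\<^sup>2) \<le> (\<Sum>k\<le>n. S * (\<Sum>s<k. \<kappa> (k - s) * (e s)\<^sup>2))"
    by (intro sum_mono cs)
  also have "\<dots> = S * (\<Sum>k\<le>n. \<Sum>s<k. \<kappa> (k - s) * (e s)\<^sup>2)" by (simp add: sum_distrib_left)
  also have "(\<Sum>k\<le>n. \<Sum>s<k. \<kappa> (k - s) * (e s)\<^sup>2) = (\<Sum>s<n. \<Sum>k\<in>{s<..n}. \<kappa> (k - s) * (e s)\<^sup>2)"
    by (simp add: sum.Sigma) (rule sum.reindex_bij_witness[of _ "\<lambda>(s, k). (k, s)" "\<lambda>(k, s). (s, k)"], auto)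
  also have "\<dots> = (\<Sum>s<n. (\<Sum>k\<in>{s<..n}. \<kappa> (k - s)) * (e s)\<^sup>2)" by (simp add: sum_distrib_right)
  also have "\<dots> \<le> (\<Sum>s<n. S * (e s)\<^sup>2)" by (intro sum_mono mult_right_mono reidx2) simp
  also have "\<dots> = S * (\<Sum>s<n. (e s)\<^sup>2)" by (simp add: sum_distrib_left)
  finally show ?thesis using S0 unfolding S_def power2_eq_square by (simp add: mult_left_mono mult.assoc)
qed

lemma power2_sum3_le: "(x + y + z)\<^sup>2 \<le> 3 * (x\<^sup>2 + y\<^sup>2 + (z::real)\<^sup>2)"
proof -
  have "0 \<le> (x - y)\<^sup>2 + (y - z)\<^sup>2 + (x - z)\<^sup>2" by simp
  then show ?thesis by (simp add: power2_eq_square algebra_simps)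
qed

lemma power2_sum2_le: "(x + y)\<^sup>2 \<le> 2 * (x\<^sup>2 + (y::real)\<^sup>2)"
proof -
  have "0 \<le> (x - y)\<^sup>2" by simp
  then show ?thesis by (simp add: power2_eq_square algebra_simps)
qed

lemma sum_square_le_convolution:
  fixes U c \<kappa> e :: "nat \<Rightarrow> real"
  assumes \<kappa>: "\<And>n. 0 \<le> \<kappa> n" "summable \<kappa>" and c: "summable (\<lambda>k. (c k)\<^sup>2)" and U: "\<And>k. 0 \<le> U k"
    and le: "\<And>k. U k \<le> c k + (\<Sum>s<k. \<kappa> (k - s) * e s)"
  shows "(\<Sum>k\<le>n. (U k)\<^sup>2) \<le> 2 * (\<Sum>k. (c k)\<^sup>2) + 2 * (suminf \<kappa>)\<^sup>2 * (\<Sum>s<n. (e s)\<^sup>2)"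
proof -
  have "(U k)\<^sup>2 \<le> 2 * ((c k)\<^sup>2 + (\<Sum>s<k. \<kappa> (k - s) * e s)\<^sup>2)" for k
    using power_mono[OF le U, of k 2] power2_sum2_le order_trans by blast
  then have "(\<Sum>k\<le>n. (U k)\<^sup>2) \<le> (\<Sum>k\<le>n. 2 * ((c k)\<^sup>2 + (\<Sum>s<k. \<kappa> (k - s) * e s)\<^sup>2))"
    by (intro sum_mono)
  also have "\<dots> = 2 * (\<Sum>k\<le>n. (c k)\<^sup>2) + 2 * (\<Sum>k\<le>n. (\<Sum>s<k. \<kappa> (k - s) * e s)\<^sup>2)"
    by (simp add: sum.distrib sum_distrib_left[symmetric])
  also have "(\<Sum>k\<le>n. (c k)\<^sup>2) \<le> (\<Sum>k. (c k)\<^sup>2)" by (rule sum_le_suminf[OF c]) auto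
  finally show ?thesis using sum_convolution_square_le[OF \<kappa>, of e n] by simp
qed

text \<open>In the application \<open>G\<close> is the gradient norm at \<open>y\<close>,
  \<open>U\<close> the disagreement, \<open>Q\<close> the tracking error, \<open>\<Delta>\<close>
  the size of the gradient increments and \<open>e\<close> the length of the steps. The squared sums
  of \<open>U\<close>, \<open>\<Delta>\<close> and \<open>Q\<close> are affinely bounded by that of
  \<open>e\<close>, with arbitrary gains; that of \<open>e\<close> is eventually bounded by a
  multiple of \<open>\<epsilon>\<close> times the decrease plus a multiple of
  \<open>\<epsilon>\<^sup>2\<close> times the squared errors.\<close>

theorem small_gain:
  fixes \<gamma> G U Q \<Delta> e \<Phi> c0 c1 \<kappa> \<kappa>' :: "nat \<Rightarrow> real"
  assumes \<gamma>: "\<And>k. 0 \<le> \<gamma> k" "\<gamma> \<longlonglongrightarrow> 0"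
    and nn: "\<And>k. 0 \<le> G k" "\<And>k. 0 \<le> U k" "\<And>k. 0 \<le> Q k" "\<And>k. 0 \<le> e k" "\<And>k. 0 \<le> \<Delta> k"
    and \<kappa>: "\<And>n. 0 \<le> \<kappa> n" "summable \<kappa>" and \<kappa>': "\<And>n. 0 \<le> \<kappa>' n" "summable \<kappa>'"
    and c0: "summable (\<lambda>k. (c0 k)\<^sup>2)" and c1: "summable (\<lambda>k. (c1 k)\<^sup>2)"
    and a: "0 < a" and L: "0 \<le> L"
    and U_le: "\<And>k. U k \<le> c0 k + (\<Sum>s<k. \<kappa> (k - s) * e s)"
    and Q_le: "\<And>k. Q k \<le> c1 k + (\<Sum>s<k. \<kappa>' (k - s) * \<Delta> s)"
    and \<Delta>_le: "\<And>s. \<Delta> s \<le> L * (U (Suc s) + U s + e s)"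
    and e_le: "\<And>k. e k \<le> \<gamma> k * (G k + (Q k + L * U k))"
    and descent: "\<And>k. K\<^sub>1 \<le> k \<Longrightarrow> \<Phi> (Suc k) \<le> \<Phi> k - a * (\<gamma> k * (G k)\<^sup>2)
        + \<gamma> k * (G k * (Q k + L * U k)) + L * (e k)\<^sup>2"
    and \<Phi>_ge: "\<And>k. B \<le> \<Phi> k"
  shows "\<exists>C. \<forall>n. (\<Sum>k<n. \<gamma> k * ((G k)\<^sup>2 + (U k)\<^sup>2)) \<le> C"
proof -
  define R where "R k = Q k + L * U k" for k
  define E where "E n = (\<Sum>s<n. (e s)\<^sup>2)" for n
  define Y where "Y n = (\<Sum>k\<le>n. (R k)\<^sup>2)" for n
  define s0 where "s0 = 2 * (\<Sum>k. (c0 k)\<^sup>2)"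
  define s1 where "s1 = 2 * (suminf \<kappa>)\<^sup>2"
  define t0 where "t0 = 2 * (\<Sum>k. (c1 k)\<^sup>2)"
  define t1 where "t1 = 2 * (suminf \<kappa>')\<^sup>2"
  have nn': "0 \<le> s1" "0 \<le> t1" unfolding s1_def t1_def by auto
  have R0: "0 \<le> R k" for k unfolding R_def using nn L by simp
  have E0: "0 \<le> E n" for n unfolding E_def by (simp add: sum_nonneg)
  have Y0: "0 \<le> Y n" for n unfolding Y_def by (simp add: sum_nonneg)
  have US: "(\<Sum>k\<le>n. (U k)\<^sup>2) \<le> s0 + s1 * E n" for n
    using sum_square_le_convolution[OF \<kappa> c0 nn(2) U_le, of n] unfolding s0_def s1_def E_def by simp
  have DS: "(\<Sum>s<n. (\<Delta> s)\<^sup>2) \<le> 3 * L\<^sup>2 * (2 * s0 + (2 * s1 + 1) * E n)" for n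
  proof -
    have "(\<Delta> s)\<^sup>2 \<le> 3 * L\<^sup>2 * ((U (Suc s))\<^sup>2 + (U s)\<^sup>2 + (e s)\<^sup>2)" for s
    proof -
      have "(\<Delta> s)\<^sup>2 \<le> L\<^sup>2 * (U (Suc s) + U s + e s)\<^sup>2"
        using power_mono[OF \<Delta>_le nn(5), of s 2] by (simp add: power_mult_distrib)
      also have "\<dots> \<le> L\<^sup>2 * (3 * ((U (Suc s))\<^sup>2 + (U s)\<^sup>2 + (e s)\<^sup>2))"
        by (intro mult_left_mono power2_sum3_le) simp
      finally show ?thesis by (simp add: algebra_simps)
    qed
    then have "(\<Sum>s<n. (\<Delta> s)\<^sup>2) \<le> (\<Sum>s<n. 3 * L\<^sup>2 * ((U (Suc s))\<^sup>2 + (U s)\<^sup>2 + (e s)\<^sup>2))"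
      by (intro sum_mono)
    also have "\<dots> = 3 * L\<^sup>2 * ((\<Sum>s<n. (U (Suc s))\<^sup>2) + (\<Sum>s<n. (U s)\<^sup>2) + E n)"
      by (simp add: sum_distrib_left[symmetric] sum.distrib E_def)
    also have "\<dots> \<le> 3 * L\<^sup>2 * (2 * s0 + (2 * s1 + 1) * E n)"
    proof (rule mult_left_mono)
      \<comment> \<open>\<open>\<Delta>\<close> reads \<open>U\<close> one step ahead, up to index
        \<open>n\<close>. The convolution is strictly causal, so \<open>U n\<close> still involves
        only \<open>e s\<close> with \<open>s < n\<close>, and \<open>E n\<close> suffices.\<close>
      have "(\<Sum>s<n. (U (Suc s))\<^sup>2) = (\<Sum>k\<in>{Suc 0..<Suc n}. (U k)\<^sup>2)"
        by (simp only: atLeast0LessThan[symmetric] sum.shift_bounds_Suc_ivl)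
      also have "\<dots> \<le> (\<Sum>k\<le>n. (U k)\<^sup>2)" by (rule sum_mono2) auto
      finally have "(\<Sum>s<n. (U (Suc s))\<^sup>2) \<le> s0 + s1 * E n" using US[of n] by linarith
      moreover have "(\<Sum>s<n. (U s)\<^sup>2) \<le> (\<Sum>k\<le>n. (U k)\<^sup>2)" by (rule sum_mono2) auto
      ultimately show "(\<Sum>s<n. (U (Suc s))\<^sup>2) + (\<Sum>s<n. (U s)\<^sup>2) + E n \<le> 2 * s0 + (2 * s1 + 1) * E n"
        using US[of n] by (simp add: algebra_simps)
    qed simp
    finally show ?thesis .
  qed
  define d1 where "d1 = 2 * (t0 + t1 * (3 * L\<^sup>2 * (2 * s0))) + 2 * L\<^sup>2 * s0"
  define d2 where "d2 = 2 * (t1 * (3 * L\<^sup>2 * (2 * s1 + 1))) + 2 * L\<^sup>2 * s1"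
  have d2: "0 \<le> d2" unfolding d2_def using nn' by simp
  have YE: "Y n \<le> d1 + d2 * E n" for n
  proof -
    have "(R k)\<^sup>2 \<le> 2 * ((Q k)\<^sup>2 + L\<^sup>2 * (U k)\<^sup>2)" for k
      unfolding R_def using power2_sum2_le[of "Q k" "L * U k"] by (simp add: power_mult_distrib)
    then have "Y n \<le> (\<Sum>k\<le>n. 2 * ((Q k)\<^sup>2 + L\<^sup>2 * (U k)\<^sup>2))" unfolding Y_def by (intro sum_mono)
    also have "\<dots> = 2 * (\<Sum>k\<le>n. (Q k)\<^sup>2) + 2 * L\<^sup>2 * (\<Sum>k\<le>n. (U k)\<^sup>2)"
      by (simp add: sum.distrib sum_distrib_left distrib_left mult.assoc)
    also have "\<dots> \<le> 2 * (t0 + t1 * (3 * L\<^sup>2 * (2 * s0 + (2 * s1 + 1) * E n))) + 2 * L\<^sup>2 * (s0 + s1 * E n)"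
    proof (intro add_mono mult_left_mono US)
      have "(\<Sum>k\<le>n. (Q k)\<^sup>2) \<le> t0 + t1 * (\<Sum>s<n. (\<Delta> s)\<^sup>2)"
        using sum_square_le_convolution[OF \<kappa>' c1 nn(3) Q_le, of n] unfolding t0_def t1_def by simp
      also have "\<dots> \<le> t0 + t1 * (3 * L\<^sup>2 * (2 * s0 + (2 * s1 + 1) * E n))"
        by (intro add_left_mono mult_left_mono DS nn')
      finally show "(\<Sum>k\<le>n. (Q k)\<^sup>2) \<le> \<dots>" .
    qed auto
    also have "\<dots> = d1 + d2 * E n" unfolding d1_def d2_def by (simp add: algebra_simps)
    finally show ?thesis .
  qed
  \<comment> \<open>An upper bound for \<open>4 * d2 * A2 + 2 * L\<close>, with 1 put for
    \<open>\<epsilon>\<close> in \<open>A2\<close>: the coefficient of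
    \<open>\<epsilon> * S n\<close> that competes with the decrease
    \<open>(a / 2) * S n\<close>.\<close>
  define b where "b = 2 * d2 / a + 8 * L * d2 + 2 * L"
  have b0: "0 \<le> b" unfolding b_def using a L d2 by simp
  \<comment> \<open>The first bound lets \<open>Y\<close> be absorbed into itself; the second makes
    the errors use up at most half of the decrease \<open>(a / 2) * S n\<close>.\<close>
  define \<epsilon> where "\<epsilon> = min (1 / (4 * d2 + 4)) (a / (4 * (b + 1)))"
  have \<epsilon>0: "0 < \<epsilon>" unfolding \<epsilon>_def using a b0 d2 by simp
  have \<epsilon>1: "\<epsilon> \<le> 1"
  proof -
    have "1 / (4 * d2 + 4) \<le> 1" using d2 by simp
    then show ?thesis unfolding \<epsilon>_def by linarith
  qed
  have \<epsilon>d: "4 * d2 * \<epsilon> \<le> 1"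
  proof -
    have "\<epsilon> \<le> 1 / (4 * d2 + 4)" unfolding \<epsilon>_def by simp
    then have "\<epsilon> * (4 * d2 + 4) \<le> 1" using d2 by (simp add: field_simps)
    then show ?thesis using \<epsilon>0 by (simp add: algebra_simps)
  qed
  have \<epsilon>b: "b * \<epsilon> \<le> a / 4"
  proof -
    have "\<epsilon> \<le> a / (4 * (b + 1))" unfolding \<epsilon>_def by simp
    then have "\<epsilon> * (4 * (b + 1)) \<le> a" using b0 by (simp add: field_simps)
    then show ?thesis using \<epsilon>0 by (simp add: algebra_simps)
  qed
  have \<epsilon>sq: "\<epsilon>\<^sup>2 \<le> \<epsilon>" using \<epsilon>0 \<epsilon>1 by (simp add: power2_eq_square mult_left_le)
  have "eventually (\<lambda>k. \<gamma> k < \<epsilon>) sequentially" using \<gamma>(2) \<epsilon>0 by (intro order_tendstoD(2))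
  then obtain K0 where K0: "\<And>k. K0 \<le> k \<Longrightarrow> \<gamma> k < \<epsilon>" unfolding eventually_sequentially by blast
  \<comment> \<open>From \<open>K\<close> on the step sizes are below \<open>\<epsilon>\<close> and
    the descent inequality is available; everything earlier is a constant.\<close>
  define K where "K = max K0 K\<^sub>1"
  have g\<epsilon>: "\<gamma> k \<le> \<epsilon>" if "K \<le> k" for k using K0[of k] that unfolding K_def by simp
  define S where "S n = (\<Sum>k\<in>{K..<n}. \<gamma> k * (G k)\<^sup>2)" for n
  have S0: "0 \<le> S n" for n unfolding S_def using \<gamma> by (simp add: sum_nonneg)
  have RS: "(\<Sum>k\<in>{K..<n}. (R k)\<^sup>2) \<le> Y n" for n unfolding Y_def by (rule sum_mono2) auto
  have ES: "(\<Sum>k\<in>{K..<n}. (e k)\<^sup>2) \<le> 2 * \<epsilon> * S n + 2 * \<epsilon>\<^sup>2 * Y n" for n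
  proof -
    have "(e k)\<^sup>2 \<le> 2 * \<epsilon> * (\<gamma> k * (G k)\<^sup>2) + 2 * \<epsilon>\<^sup>2 * (R k)\<^sup>2" if "K \<le> k" for k
    proof -
      have "(e k)\<^sup>2 \<le> (\<gamma> k)\<^sup>2 * (G k + R k)\<^sup>2"
        using power_mono[OF e_le nn(4), of k 2] by (simp add: power_mult_distrib R_def)
      also have "\<dots> \<le> (\<gamma> k)\<^sup>2 * (2 * ((G k)\<^sup>2 + (R k)\<^sup>2))" by (intro mult_left_mono power2_sum2_le) simp
      also have "\<dots> = 2 * ((\<gamma> k * \<gamma> k) * (G k)\<^sup>2) + 2 * (\<gamma> k)\<^sup>2 * (R k)\<^sup>2"
        by (simp add: power2_eq_square algebra_simps)
      also have "\<dots> \<le> 2 * ((\<epsilon> * \<gamma> k) * (G k)\<^sup>2) + 2 * \<epsilon>\<^sup>2 * (R k)\<^sup>2"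
        using g\<epsilon>[OF that] \<gamma>(1)[of k] by (intro add_mono mult_left_mono mult_right_mono power_mono) auto
      finally show ?thesis by (simp add: mult.assoc)
    qed
    then have "(\<Sum>k\<in>{K..<n}. (e k)\<^sup>2) \<le> (\<Sum>k\<in>{K..<n}. 2 * \<epsilon> * (\<gamma> k * (G k)\<^sup>2) + 2 * \<epsilon>\<^sup>2 * (R k)\<^sup>2)"
      by (intro sum_mono) simp
    also have "\<dots> = 2 * \<epsilon> * S n + 2 * \<epsilon>\<^sup>2 * (\<Sum>k\<in>{K..<n}. (R k)\<^sup>2)"
      by (simp add: sum.distrib sum_distrib_left S_def)
    also have "\<dots> \<le> 2 * \<epsilon> * S n + 2 * \<epsilon>\<^sup>2 * Y n" by (intro add_left_mono mult_left_mono RS) simp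
    finally show ?thesis .
  qed
  have EK: "E n \<le> E K + 2 * \<epsilon> * S n + 2 * \<epsilon>\<^sup>2 * Y n" if "K \<le> n" for n
  proof -
    have "E n = E K + (\<Sum>k\<in>{K..<n}. (e k)\<^sup>2)"
      unfolding E_def using sum.atLeastLessThan_concat[of 0 K n "\<lambda>s. (e s)\<^sup>2"] that
      by (simp add: atLeast0LessThan)
    then show ?thesis using ES[of n] by simp
  qed
  \<comment> \<open>The loop from \<open>Y\<close> through \<open>E\<close> back to \<open>Y\<close>
    has gain at most 1/2; moving this half to the left doubles the constants.\<close>
  define A1 where "A1 = 2 * (\<bar>d1\<bar> + d2 * E K)"
  have A1: "0 \<le> A1" unfolding A1_def using d2 E0 by simp
  have YS: "Y n \<le> A1 + 4 * d2 * \<epsilon> * S n" if "K \<le> n" for n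
  proof -
    have "Y n \<le> d1 + d2 * (E K + 2 * \<epsilon> * S n + 2 * \<epsilon>\<^sup>2 * Y n)"
      using YE[of n] mult_left_mono[OF EK[OF that] d2] by linarith
    also have "\<dots> = d1 + d2 * E K + 2 * d2 * \<epsilon> * S n + (2 * d2 * \<epsilon>\<^sup>2) * Y n" by (simp add: algebra_simps)
    also have "(2 * d2 * \<epsilon>\<^sup>2) * Y n \<le> (1 / 2) * Y n"
    proof (rule mult_right_mono[OF _ Y0])
      have "2 * d2 * \<epsilon>\<^sup>2 \<le> 2 * d2 * \<epsilon>" using d2 \<epsilon>sq by (intro mult_left_mono) auto
      then show "2 * d2 * \<epsilon>\<^sup>2 \<le> 1 / 2" using \<epsilon>d by linarith
    qed
    finally show ?thesis unfolding A1_def by (simp add: algebra_simps)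
  qed
  define A2 where "A2 = \<epsilon> / (2 * a) + 2 * L * \<epsilon>\<^sup>2"
  have A2: "0 \<le> A2" unfolding A2_def using a L \<epsilon>0 by simp
  have desc: "\<Phi> n \<le> \<Phi> K - (a / 2) * S n + A2 * Y n + 2 * L * \<epsilon> * S n" if "K \<le> n" for n
  proof -
    have st: "\<Phi> (Suc k) - \<Phi> k \<le> - (a / 2) * (\<gamma> k * (G k)\<^sup>2) + (\<epsilon> / (2 * a)) * (R k)\<^sup>2 + L * (e k)\<^sup>2"
      if "K \<le> k" for k
    proof -
      \<comment> \<open>Young's inequality splits the cross term: half of the decrease pays for
        \<open>G\<close>, the rest is a squared error in \<open>R\<close>.\<close>
      have "0 \<le> (a * G k - R k)\<^sup>2" by simp
      then have "G k * R k \<le> (a / 2) * (G k)\<^sup>2 + (1 / (2 * a)) * (R k)\<^sup>2"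
        using a by (simp add: power2_eq_square field_simps)
      then have "\<gamma> k * (G k * R k) \<le> \<gamma> k * ((a / 2) * (G k)\<^sup>2 + (1 / (2 * a)) * (R k)\<^sup>2)"
        using \<gamma> by (intro mult_left_mono) auto
      also have "\<dots> = (a / 2) * (\<gamma> k * (G k)\<^sup>2) + \<gamma> k * ((1 / (2 * a)) * (R k)\<^sup>2)"
        by (simp add: algebra_simps)
      also have "\<dots> \<le> (a / 2) * (\<gamma> k * (G k)\<^sup>2) + \<epsilon> * ((1 / (2 * a)) * (R k)\<^sup>2)"
        using g\<epsilon>[OF that] a by (intro add_left_mono mult_right_mono) auto
      finally show ?thesis using descent[of k] that unfolding K_def R_def by simp
    qed
    have "\<Phi> n - \<Phi> K = (\<Sum>k\<in>{K..<n}. \<Phi> (Suc k) - \<Phi> k)" using that by (simp add: sum_Suc_diff')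
    also have "\<dots> \<le> (\<Sum>k\<in>{K..<n}. - (a / 2) * (\<gamma> k * (G k)\<^sup>2) + (\<epsilon> / (2 * a)) * (R k)\<^sup>2 + L * (e k)\<^sup>2)"
      by (intro sum_mono st) simp
    also have "\<dots> = - (a / 2) * S n + (\<epsilon> / (2 * a)) * (\<Sum>k\<in>{K..<n}. (R k)\<^sup>2) + L * (\<Sum>k\<in>{K..<n}. (e k)\<^sup>2)"
      unfolding S_def by (simp only: sum.distrib sum_distrib_left)
    also have "\<dots> \<le> - (a / 2) * S n + (\<epsilon> / (2 * a)) * Y n + L * (2 * \<epsilon> * S n + 2 * \<epsilon>\<^sup>2 * Y n)"
      using a \<epsilon>0 L by (intro add_mono order_refl mult_left_mono RS ES) auto
    finally show ?thesis unfolding A2_def by (simp add: algebra_simps)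
  qed
  define Sb where "Sb = (4 / a) * (\<Phi> K - B + A2 * A1)"
  have SB: "S n \<le> Sb" if "K \<le> n" for n
  proof -
    have "(a / 2) * S n \<le> \<Phi> K - B + A2 * (A1 + 4 * d2 * \<epsilon> * S n) + 2 * L * \<epsilon> * S n"
      using desc[OF that] \<Phi>_ge[of n] mult_left_mono[OF YS[OF that] A2] by linarith
    also have "\<dots> = \<Phi> K - B + A2 * A1 + (4 * d2 * A2 + 2 * L) * \<epsilon> * S n" by (simp add: algebra_simps)
    also have "\<dots> \<le> \<Phi> K - B + A2 * A1 + (a / 4) * S n"
    proof (intro add_left_mono mult_right_mono S0)
      have "A2 \<le> 1 / (2 * a) + 2 * L * 1"
        unfolding A2_def using a L \<epsilon>1 \<epsilon>sq by (intro add_mono mult_left_mono divide_right_mono) auto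
      then have "4 * d2 * A2 \<le> 4 * d2 * (1 / (2 * a) + 2 * L * 1)" using d2 by (intro mult_left_mono) auto
      also have "\<dots> = 2 * d2 / a + 8 * L * d2" using a by (simp add: field_simps)
      finally have "4 * d2 * A2 + 2 * L \<le> b" unfolding b_def by simp
      then have "(4 * d2 * A2 + 2 * L) * \<epsilon> \<le> b * \<epsilon>" using \<epsilon>0 by (intro mult_right_mono) auto
      then show "(4 * d2 * A2 + 2 * L) * \<epsilon> \<le> a / 4" using \<epsilon>b by linarith
    qed
    finally have "(a / 4) * S n \<le> \<Phi> K - B + A2 * A1" by simp
    then show ?thesis unfolding Sb_def using a by (simp add: field_simps)
  qed
  \<comment> \<open>Back-substitution: the bound on \<open>S\<close> bounds \<open>Y\<close>, then
    \<open>E\<close>, then the squares of \<open>U\<close>.\<close>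
  define Yb where "Yb = A1 + 4 * d2 * \<epsilon> * Sb"
  define Eb where "Eb = E K + 2 * \<epsilon> * Sb + 2 * \<epsilon>\<^sup>2 * Yb"
  have YB: "Y n \<le> Yb" if "K \<le> n" for n
    using YS[OF that] mult_left_mono[OF SB[OF that], of "4 * d2 * \<epsilon>"] d2 \<epsilon>0 unfolding Yb_def by simp
  have EB: "E n \<le> Eb" if "K \<le> n" for n
  proof -
    have "2 * \<epsilon> * S n \<le> 2 * \<epsilon> * Sb" "2 * \<epsilon>\<^sup>2 * Y n \<le> 2 * \<epsilon>\<^sup>2 * Yb"
      using \<epsilon>0 by (intro mult_left_mono SB YB that; simp)+
    then show ?thesis using EK[OF that] unfolding Eb_def by linarith
  qed
  define C where "C = (\<Sum>k<K. \<gamma> k * ((G k)\<^sup>2 + (U k)\<^sup>2)) + Sb + \<epsilon> * (s0 + s1 * Eb)"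
  have main: "(\<Sum>k<n. \<gamma> k * ((G k)\<^sup>2 + (U k)\<^sup>2)) \<le> C" if "K \<le> n" for n
  proof -
    have "(\<Sum>k<n. \<gamma> k * ((G k)\<^sup>2 + (U k)\<^sup>2)) = (\<Sum>k<K. \<gamma> k * ((G k)\<^sup>2 + (U k)\<^sup>2))
        + (\<Sum>k\<in>{K..<n}. \<gamma> k * ((G k)\<^sup>2 + (U k)\<^sup>2))"
      using sum.atLeastLessThan_concat[of 0 K n "\<lambda>k. \<gamma> k * ((G k)\<^sup>2 + (U k)\<^sup>2)"] that
      by (simp add: atLeast0LessThan)
    moreover have "(\<Sum>k\<in>{K..<n}. \<gamma> k * ((G k)\<^sup>2 + (U k)\<^sup>2)) = S n + (\<Sum>k\<in>{K..<n}. \<gamma> k * (U k)\<^sup>2)"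
      unfolding S_def by (simp add: distrib_left sum.distrib)
    moreover have "(\<Sum>k\<in>{K..<n}. \<gamma> k * (U k)\<^sup>2) \<le> (\<Sum>k\<in>{K..<n}. \<epsilon> * (U k)\<^sup>2)"
      by (intro sum_mono mult_right_mono g\<epsilon>) auto
    moreover have "\<dots> \<le> (\<Sum>k\<le>n. \<epsilon> * (U k)\<^sup>2)" using \<epsilon>0 by (intro sum_mono2) auto
    moreover have "\<dots> = \<epsilon> * (\<Sum>k\<le>n. (U k)\<^sup>2)" by (simp add: sum_distrib_left)
    moreover have "\<dots> \<le> \<epsilon> * (s0 + s1 * Eb)"
    proof (rule mult_left_mono)
      show "(\<Sum>k\<le>n. (U k)\<^sup>2) \<le> s0 + s1 * Eb"
        using US[of n] mult_left_mono[OF EB[OF that] nn'(1)] by linarith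
    qed (use \<epsilon>0 in simp)
    ultimately show ?thesis unfolding C_def using SB[OF that] by linarith
  qed
  have "(\<Sum>k<n. \<gamma> k * ((G k)\<^sup>2 + (U k)\<^sup>2)) \<le> C" for n
  proof -
    have "(\<Sum>k<n. \<gamma> k * ((G k)\<^sup>2 + (U k)\<^sup>2)) \<le> (\<Sum>k<max n K. \<gamma> k * ((G k)\<^sup>2 + (U k)\<^sup>2))"
      using \<gamma> by (intro sum_mono2) auto
    then show ?thesis using main[of "max n K"] by simp
  qed
  then show ?thesis by blast
qed

section \<open>Consensus and gradient tracking over an asynchronous network\<close>

lemma summable_power2:
  fixes c :: "nat \<Rightarrow> real"
  assumes c: "summable c" and nonneg: "\<And>n. 0 \<le> c n"
  shows "summable (\<lambda>n. (c n)\<^sup>2)"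
proof (rule summable_comparison_test_ev[OF _ c])
  have "eventually (\<lambda>n. c n < 1) sequentially"
    using summable_LIMSEQ_zero[OF c] by (intro order_tendstoD(2)) auto
  then show "eventually (\<lambda>n. norm ((c n)\<^sup>2) \<le> c n) sequentially"
    by eventually_elim (use nonneg in \<open>auto simp: power2_eq_square intro: mult_left_le\<close>)
qed

text \<open>All that is kept of the delays is in the conditions on \<open>tau\<close>.
  \<open>tau_active\<close> limits the age of what the active agent reads; \<open>tau_mono\<close>
  makes the set of readable messages grow, so that each message is absorbed exactly once.\<close>

locale asynchronous_network =
  fixes V :: "nat set" and E :: "(nat \<times> nat) set" and ik :: "nat \<Rightarrow> nat" and T D :: nat
    and tau :: "nat \<Rightarrow> nat \<Rightarrow> nat \<Rightarrow> int"
  assumes finite_V: "finite V" and V_nonempty: "V \<noteq> {}"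
    and E_sub: "E \<subseteq> V \<times> V" and E_irrefl: "(i, i) \<notin> E"
    and E_strong: "i \<in> V \<Longrightarrow> j \<in> V \<Longrightarrow> (i, j) \<in> E\<^sup>*"
    and ik_V: "ik k \<in> V"
    and ik_T: "i \<in> V \<Longrightarrow> \<exists>t. k \<le> t \<and> t < k + T \<and> ik t = i"
    and tau_ge: "i \<in> V \<Longrightarrow> j \<in> in_nbrs V E i \<Longrightarrow> - int D \<le> tau k i j"
    and tau_le: "i \<in> V \<Longrightarrow> j \<in> in_nbrs V E i \<Longrightarrow> tau k i j \<le> int k"
    and tau_active: "j \<in> in_nbrs V E (ik k) \<Longrightarrow> int k - int D \<le> tau k (ik k) j"
    and tau_mono: "i \<in> V \<Longrightarrow> j \<in> in_nbrs V E i \<Longrightarrow> k \<le> k' \<Longrightarrow> tau k i j \<le> tau k' i j"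
begin

section \<open>The two averaging graphs of the network\<close>

lemma averaging_graph_rows:
  assumes "0 < m" "m < 1" and adm: "admissible_weights V E m W" and row: "row_stochastic V W"
  shows "averaging_graph V (in_nbrs V E) W m"
proof
  fix i j
  have R: "{(a, b). b \<in> V \<and> a \<in> in_nbrs V E b} = E" using E_sub by (auto simp: in_nbrs_def)
  show "(i, j) \<in> {(a, b). b \<in> V \<and> a \<in> in_nbrs V E b}\<^sup>*" if "i \<in> V" "j \<in> V"
    unfolding R using E_strong that .
  show "W i i + (\<Sum>j\<in>in_nbrs V E i. W i j) = 1" if i: "i \<in> V"
  proof -
    have "(\<Sum>j\<in>V. W i j) = (\<Sum>j\<in>insert i (in_nbrs V E i). W i j)"
      using adm i finite_V unfolding admissible_weights_def
      by (intro sum.mono_neutral_right) (auto simp: in_nbrs_def)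
    also have "\<dots> = W i i + (\<Sum>j\<in>in_nbrs V E i. W i j)"
      using E_irrefl finite_V by (subst sum.insert) (auto simp: in_nbrs_def)
    finally show ?thesis using row i unfolding row_stochastic_def by simp
  qed
qed (use assms finite_V V_nonempty in \<open>auto simp: in_nbrs_def admissible_weights_def\<close>)

text \<open>By column stochasticity an agent splits its mass completely between itself and its
  out-neighbours. Read backwards in time, the fractions are averaging weights on the graph with
  reversed edges, which is strongly connected too.\<close>

lemma averaging_graph_columns:
  assumes "0 < m" "m < 1" and adm: "admissible_weights V E m A" and col: "column_stochastic V A"
  shows "averaging_graph V (out_nbrs V E) (\<lambda>i l. A l i) m"
proof
  fix i j
  have R: "{(a, b). b \<in> V \<and> a \<in> out_nbrs V E b} = E\<inverse>" using E_sub by (auto simp: out_nbrs_def)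
  show "(i, j) \<in> {(a, b). b \<in> V \<and> a \<in> out_nbrs V E b}\<^sup>*" if "i \<in> V" "j \<in> V"
    unfolding R using E_strong that by (simp add: rtrancl_converse)
  show "A i i + (\<Sum>l\<in>out_nbrs V E i. A l i) = 1" if i: "i \<in> V"
  proof -
    have "(\<Sum>l\<in>V. A l i) = (\<Sum>l\<in>insert i (out_nbrs V E i). A l i)"
      using adm i finite_V unfolding admissible_weights_def
      by (intro sum.mono_neutral_right) (auto simp: out_nbrs_def)
    also have "\<dots> = A i i + (\<Sum>l\<in>out_nbrs V E i. A l i)"
      using E_irrefl finite_V by (subst sum.insert) (auto simp: out_nbrs_def)
    finally show ?thesis using col i unfolding column_stochastic_def by simp
  qed
qed (use assms finite_V V_nonempty in \<open>auto simp: out_nbrs_def admissible_weights_def\<close>)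

section \<open>Consensus: elimination of \<open>v\<close> in shifted time\<close>

text \<open>Times are shifted by one, so that 0 can stand for an agent that has not been active yet.\<close>
definition last_update :: "nat \<Rightarrow> int \<Rightarrow> nat" where
  "last_update j t = (if \<exists>s. int s < t \<and> ik s = j then Suc (GREATEST s. int s < t \<and> ik s = j) else 0)"

text \<open>An agent's \<open>v\<close> is constant between its activations, so a read at time
  \<open>t\<close> returns what its last activation before \<open>t\<close> wrote; by
  \<open>ik_T\<close> any \<open>T\<close> consecutive iterations contain one.\<close>

lemma last_update_bounds:
  assumes j: "j \<in> V" and t: "t \<le> int k"
  shows "last_update j t \<le> k" and "t \<le> int (last_update j t) + int T"
proof -
  have bd: "s \<le> k" if "int s < t \<and> ik s = j" for s using that t by simp
  show "last_update j t \<le> k"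
  proof (cases "\<exists>s. int s < t \<and> ik s = j")
    case True
    then have "int (GREATEST s. int s < t \<and> ik s = j) < t"
      using GreatestI_ex_nat[OF True bd] by blast
    then show ?thesis using True t unfolding last_update_def by simp
  qed (auto simp: last_update_def)
  show "t \<le> int (last_update j t) + int T"
  proof (cases "t \<le> int T")
    case False
    obtain s where s: "nat (t - int T) \<le> s" "s < nat (t - int T) + T" "ik s = j"
      using ik_T[OF j] by blast
    then have P: "int s < t \<and> ik s = j" using False by linarith
    have "s \<le> (GREATEST s. int s < t \<and> ik s = j)" by (rule Greatest_le_nat[where b = k]) (use P bd in blast)+
    then have "s < last_update j t" using P unfolding last_update_def by auto
    then show ?thesis using s False by linarith
  qed simp
qed

lemma last_update_Suc:
  "last_update j (int k + 1) = (if j = ik k then Suc k else last_update j (int k))"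
proof (cases "j = ik k")
  case True
  then have "(GREATEST s. int s < int k + 1 \<and> ik s = j) = k" by (intro Greatest_equality) auto
  then show ?thesis using True unfolding last_update_def by (auto intro!: exI[of _ k])
next
  case False
  then have "(int s < int k + 1 \<and> ik s = j) = (int s < int k \<and> ik s = j)" for s
    by (cases "s = k") auto
  then show ?thesis using False unfolding last_update_def by simp
qed

text \<open>Each read of \<open>v\<close> is an entry of the array \<open>X\<close>, in which the
  agent active at iteration \<open>n - 1\<close> carries its freshly perturbed value and the others
  carry \<open>x\<close>. For \<open>X\<close> the algorithm is plain delayed averaging, with the
  perturbations and the starting point as inputs.\<close>

theorem consensus_error:
  fixes x :: "nat \<Rightarrow> nat \<Rightarrow> 'a::real_normed_vector" and v :: "int \<Rightarrow> nat \<Rightarrow> 'a" and p :: "nat \<Rightarrow> 'a"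
  assumes m: "0 < m" "m < 1" and adm: "admissible_weights V E m W" and row: "row_stochastic V W"
    and v0: "\<And>t i. - int D \<le> t \<Longrightarrow> t \<le> 0 \<Longrightarrow> i \<in> V \<Longrightarrow> v t i = 0"
    and v_upd: "\<And>k i. i \<in> V \<Longrightarrow> v (int k + 1) i = (if i = ik k then x k i + p k else v (int k) i)"
    and x_upd: "\<And>k i. i \<in> V \<Longrightarrow> x (Suc k) i =
        (if i = ik k then W i i *\<^sub>R v (int k + 1) i + (\<Sum>j\<in>in_nbrs V E i. W i j *\<^sub>R v (tau k i j) j)
         else x k i)"
  shows "\<exists>\<kappa> c \<eta> \<psi> y. (\<forall>n. 0 \<le> \<kappa> n) \<and> summable \<kappa> \<and> (\<forall>n. 0 \<le> c n) \<and> summable c \<and> 0 < \<eta> \<and>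
    (\<forall>k. \<eta> \<le> \<psi> k \<and> \<psi> k \<le> 1) \<and> (\<forall>k. y (Suc k) = y k + \<psi> k *\<^sub>R p k) \<and>
    (\<forall>k. \<forall>j\<in>V. norm (x k j - y k) \<le> c k + (\<Sum>s<k. \<kappa> (k - s) * norm (p s)))"
proof -
  interpret averaging_graph V "in_nbrs V E" W m by (rule averaging_graph_rows[OF m adm row])
  define act where "act n = ik (n - 1)" for n
  define src where "src n l = last_update l (tau (n - 1) (ik (n - 1)) l)" for n l
  \<comment> \<open>\<open>X 0 = 0\<close> stands for the zero history of \<open>v\<close>.
    Averaging step 0 therefore acts on zeros, and \<open>inp 0\<close> injects \<open>x 0\<close>;
    all iterations of the algorithm are shifted by one.\<close>
  define X where "X n j = (if n = 0 then 0 else x (n - 1) j + (if j = ik (n - 1) then p (n - 1) else 0))" for n j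
  define inp where "inp n j = (if n = 0 then x 0 j else 0) + (if j = ik n then p n else 0)" for n j
  have vX: "v t l = X (last_update l t) l" if "- int D \<le> t" "l \<in> V" for t l
  proof (cases "t \<le> 0")
    case True
    then show ?thesis using v0 that by (simp add: last_update_def X_def)
  next
    case False
    have "v (int k) l = X (last_update l (int k)) l" for k
    proof (induction k)
      case 0 then show ?case using v0[of 0 l] that by (simp add: last_update_def X_def)
    next
      case (Suc k)
      have "v (int k + 1) l = X (last_update l (int k + 1)) l"
        using Suc v_upd[OF that(2), of k] unfolding last_update_Suc by (simp add: X_def)
      then show ?case by (simp add: add.commute)
    qed
    from this[of "nat t"] False show ?thesis by simp
  qed
  have nbV: "l \<in> V" if "l \<in> in_nbrs V E i" for l i using that by (simp add: in_nbrs_def)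
  have src: "src n l \<le> n \<and> n \<le> src n l + (T + D + 1)" if l: "l \<in> in_nbrs V E (act n)" for n l
  proof -
    have l': "l \<in> in_nbrs V E (ik (n - 1))" using l act_def by simp
    have "tau (n - 1) (ik (n - 1)) l \<le> int (n - 1)" "int (n - 1) - int D \<le> tau (n - 1) (ik (n - 1)) l"
      using tau_le[OF ik_V l'] tau_active[OF l'] by auto
    then show ?thesis
      using last_update_bounds[OF nbV[OF l], of "tau (n - 1) (ik (n - 1)) l" "n - 1"] unfolding src_def by linarith
  qed
  \<comment> \<open>The shift costs one iteration in both bounds. The delay is made up of the age
    \<open>D\<close> of the time that is read and the age \<open>T\<close> of the value found
    there.\<close>
  have sch: "schedule (T + 1) (T + D + 1) K act src" for K
    unfolding schedule_def
  proof (intro conjI allI impI ballI)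
    fix n i assume "i \<in> V"
    then obtain t where "n \<le> t" "t < n + T" "ik t = i" using ik_T by blast
    then show "\<exists>t\<ge>n. t < n + (T + 1) \<and> act t = i" by (intro exI[of _ "Suc t"]) (simp add: act_def)
  qed (use ik_V src in \<open>auto simp: act_def\<close>)
  have X_Suc: "X (Suc n) j = delayed_average (in_nbrs V E) W act src n X j + inp n j" if j: "j \<in> V" for n j
  proof (cases n)
    case 0
    have "src 0 l = 0" if "l \<in> in_nbrs V E (act 0)" for l using src[OF that] by simp
    then have "delayed_average (in_nbrs V E) W act src 0 X j = 0"
      by (auto simp: delayed_average_def X_def intro!: sum.neutral)
    then show ?thesis unfolding 0 by (simp add: X_def inp_def)
  next
    case (Suc k)
    have "x (Suc k) j = delayed_average (in_nbrs V E) W act src (Suc k) X j"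
    proof (cases "j = ik k")
      case True
      have "v (tau k j l) l = X (src (Suc k) l) l" if "l \<in> in_nbrs V E j" for l
        using vX[OF tau_ge[OF j that] nbV[OF that]] True by (simp add: src_def)
      then have "(\<Sum>l\<in>in_nbrs V E j. W j l *\<^sub>R v (tau k j l) l) = (\<Sum>l\<in>in_nbrs V E j. W j l *\<^sub>R X (src (Suc k) l) l)"
        by (intro sum.cong) auto
      then show ?thesis using x_upd[OF j, of k] v_upd[OF j, of k] True
        by (simp add: delayed_average_def act_def X_def)
    qed (use x_upd[OF j, of k] in \<open>simp add: delayed_average_def act_def X_def\<close>)
    then show ?thesis unfolding Suc by (simp add: X_def inp_def)
  qed
  have X0: "X 0 j = 0" for j by (simp add: X_def)
  from perturbed_consensus[OF _ sch X0 X_Suc]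
  obtain \<kappa> \<eta> \<psi> where \<kappa>: "\<forall>n. 0 \<le> \<kappa> n" "summable \<kappa>" and \<eta>: "0 < \<eta>"
    and \<psi>: "\<forall>s. \<forall>i\<in>V. \<eta> \<le> \<psi> s i \<and> \<psi> s i \<le> 1"
    and err: "\<forall>n. \<forall>j\<in>V. norm (X (Suc n) j - inp n j - (\<Sum>s<n. \<Sum>i\<in>V. \<psi> s i *\<^sub>R inp s i))
       \<le> (\<Sum>s<n. \<kappa> (n - s) * (\<Sum>i\<in>V. norm (inp s i)))"
    by auto
  define y0 where "y0 = (\<Sum>i\<in>V. \<psi> 0 i *\<^sub>R x 0 i)"
  define y where "y n = y0 + (\<Sum>s<n. \<psi> s (ik s) *\<^sub>R p s)" for n
  define C where "C = (\<Sum>i\<in>V. norm (x 0 i))"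
  \<comment> \<open>The first part is the fading influence of \<open>x 0\<close>. At
    \<open>k = 0\<close> the representation says nothing, since \<open>x 0\<close> is contained in
    the subtracted input \<open>inp 0\<close>; that error is added by hand.\<close>
  define c where "c n = C * \<kappa> n + (if n = 0 then C + norm y0 else 0)" for n
  have C: "0 \<le> C" unfolding C_def by (simp add: sum_nonneg)
  have inp_\<psi>: "(\<Sum>i\<in>V. \<psi> s i *\<^sub>R inp s i) = (if s = 0 then y0 else 0) + \<psi> s (ik s) *\<^sub>R p s" for s
  proof -
    have "(\<Sum>i\<in>V. \<psi> s i *\<^sub>R inp s i) = (\<Sum>i\<in>V. (if s = 0 then \<psi> 0 i *\<^sub>R x 0 i else 0) + (if i = ik s then \<psi> s i *\<^sub>R p s else 0))"
      by (intro sum.cong) (auto simp: inp_def scaleR_add_right)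
    then show ?thesis using finite_V ik_V[of s] by (simp add: sum.distrib y0_def)
  qed
  have inp_norm: "(\<Sum>i\<in>V. norm (inp s i)) \<le> (if s = 0 then C else 0) + norm (p s)" for s
  proof -
    have "(\<Sum>i\<in>V. norm (inp s i)) \<le> (\<Sum>i\<in>V. (if s = 0 then norm (x 0 i) else 0) + (if i = ik s then norm (p s) else 0))"
      by (intro sum_mono) (auto simp: inp_def norm_triangle_ineq)
    then show ?thesis using finite_V ik_V[of s] by (cases "s = 0") (simp_all add: sum.distrib C_def)
  qed
  have bound: "norm (x k j - y k) \<le> c k + (\<Sum>s<k. \<kappa> (k - s) * norm (p s))" if j: "j \<in> V" for k j
  proof (cases k)
    case 0
    have "norm (x 0 j) \<le> C" unfolding C_def using finite_V j by (intro member_le_sum) auto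
    then have "norm (x 0 j - y 0) \<le> C + norm y0" using norm_triangle_ineq4[of "x 0 j" y0] by (simp add: y_def)
    moreover have "0 \<le> C * \<kappa> 0" using C \<kappa> by simp
    ultimately show ?thesis using 0 by (simp add: c_def)
  next
    case (Suc k')
    have y: "(\<Sum>s<k. \<Sum>i\<in>V. \<psi> s i *\<^sub>R inp s i) = y k"
      unfolding inp_\<psi> y_def using Suc by (simp add: sum.distrib)
    have x: "X (Suc k) j - inp k j = x k j" using Suc by (simp add: X_def inp_def)
    have "norm (x k j - y k) \<le> (\<Sum>s<k. \<kappa> (k - s) * (\<Sum>i\<in>V. norm (inp s i)))"
      using err[rule_format, OF j, of k] unfolding x y .
    also have "\<dots> \<le> (\<Sum>s<k. \<kappa> (k - s) * ((if s = 0 then C else 0) + norm (p s)))"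
      using \<kappa> by (intro sum_mono mult_left_mono inp_norm) auto
    also have "\<dots> = (\<Sum>s<k. if s = 0 then \<kappa> k * C else 0) + (\<Sum>s<k. \<kappa> (k - s) * norm (p s))"
      unfolding sum.distrib[symmetric] by (intro sum.cong) (auto simp: distrib_left)
    also have "(\<Sum>s<k. if s = 0 then \<kappa> k * C else 0) = \<kappa> k * C" using Suc by simp
    finally show ?thesis using Suc by (simp add: c_def mult.commute)
  qed
  have cs: "summable c" unfolding c_def by (intro summable_add summable_mult \<kappa>(2) summable_single)
  have c0: "\<forall>n. 0 \<le> c n" unfolding c_def using C \<kappa> by simp
  show ?thesis
  proof (rule exI[of _ \<kappa>], rule exI[of _ c], rule exI[of _ \<eta>], rule exI[of _ "\<lambda>s. \<psi> s (ik s)"],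
      rule exI[of _ y], intro conjI)
    show "\<forall>k. \<eta> \<le> \<psi> k (ik k) \<and> \<psi> k (ik k) \<le> 1" using \<psi> ik_V by blast
    show "\<forall>k. y (Suc k) = y k + \<psi> k (ik k) *\<^sub>R p k" by (simp add: y_def)
    show "\<forall>k. \<forall>j\<in>V. norm (x k j - y k) \<le> c k + (\<Sum>s<k. \<kappa> (k - s) * norm (p s))" using bound by blast
  qed (fact \<kappa> \<eta> cs c0)+
qed

section \<open>Gradient tracking: messages, shares and their mixing\<close>

text \<open>The iteration at which agent \<open>l\<close> absorbs the mass sent to it during iteration \<open>t\<close>.\<close>
definition reception :: "nat \<Rightarrow> nat \<Rightarrow> nat" where
  "reception l t = (LEAST r. ik r = l \<and> int t < tau r l (ik t))"

text \<open>Mass sent in iteration \<open>t\<close> enters \<open>rho\<close> at time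
  \<open>t + 1\<close> and is seen by reads at times larger than \<open>t\<close>. All activations
  of \<open>l\<close> from \<open>t + D + 1\<close> on make such reads, and one of them comes within
  \<open>T\<close> iterations.\<close>

lemma reception:
  assumes l: "l \<in> out_nbrs V E (ik t)"
  shows "ik (reception l t) = l" "int t < tau (reception l t) l (ik t)" "t < reception l t"
    "reception l t \<le> t + D + T"
proof -
  have lV: "l \<in> V" and jl: "ik t \<in> in_nbrs V E l"
    using l ik_V by (auto simp: in_nbrs_def out_nbrs_def)
  obtain r where r: "t + D + 1 \<le> r" "r < t + D + 1 + T" "ik r = l" using ik_T[OF lV] by blast
  have P: "ik r = l \<and> int t < tau r l (ik t)" using tau_active[of "ik t" r] jl r by auto
  have "ik (reception l t) = l \<and> int t < tau (reception l t) l (ik t)"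
    unfolding reception_def using P by (rule LeastI)
  then show R: "ik (reception l t) = l" "int t < tau (reception l t) l (ik t)" by auto
  show "t < reception l t" using R tau_le[OF lV jl, of "reception l t"] by linarith
  have "reception l t \<le> r" unfolding reception_def using P by (rule Least_le)
  then show "reception l t \<le> t + D + T" using r by simp
qed

text \<open>By \<open>tau_mono\<close> a message stays readable once it is, so at an activation of
  the receiver the readable messages are those absorbed earlier or right now.\<close>

lemma reception_le_iff:
  assumes l: "ik k \<in> out_nbrs V E (ik t)"
  shows "reception (ik k) t \<le> k \<longleftrightarrow> int t < tau k (ik k) (ik t)"
proof
  have jl: "ik t \<in> in_nbrs V E (ik k)" using l ik_V by (auto simp: in_nbrs_def out_nbrs_def)
  show "int t < tau k (ik k) (ik t)" if "reception (ik k) t \<le> k"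
    using reception(2)[OF l] tau_mono[OF ik_V jl that] by linarith
  show "reception (ik k) t \<le> k" if "int t < tau k (ik k) (ik t)"
    unfolding reception_def using that by (intro Least_le) simp
qed

text \<open>\<open>rho\<close> is the running total of what was sent over an edge,
  \<open>rhot\<close> that of what was absorbed. With messages sorted by \<open>reception\<close>,
  the difference at the active agent keeps those received exactly now.\<close>

lemma received_mass:
  fixes zh :: "nat \<Rightarrow> 'a::real_vector"
  assumes rho0: "\<And>t i j. - int D \<le> t \<Longrightarrow> t \<le> 0 \<Longrightarrow> i \<in> V \<Longrightarrow> j \<in> V \<Longrightarrow> rho t i j = 0"
    and rhot0: "\<And>i j. i \<in> V \<Longrightarrow> j \<in> V \<Longrightarrow> rhot 0 i j = 0"
    and rho_upd: "\<And>k i j. j \<in> V \<Longrightarrow> i \<in> V \<Longrightarrow> rho (int k + 1) j i =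
        (if i = ik k \<and> j \<in> out_nbrs V E i then rho (int k) j i + A j i *\<^sub>R zh k else rho (int k) j i)"
    and rhot_upd: "\<And>k i j. i \<in> V \<Longrightarrow> j \<in> V \<Longrightarrow> rhot (Suc k) i j =
        (if i = ik k \<and> j \<in> in_nbrs V E i then rho (tau k i j) i j else rhot k i j)"
  shows "(\<Sum>j\<in>in_nbrs V E (ik k). rho (tau k (ik k) j) (ik k) j - rhot k (ik k) j) =
    (\<Sum>t<k. if ik k \<in> out_nbrs V E (ik t) \<and> reception (ik k) t = k then A (ik k) (ik t) *\<^sub>R zh t else 0)"
proof -
  have edge: "l \<in> V" "j \<in> V" "j \<in> in_nbrs V E l" if "l \<in> out_nbrs V E j" for l j
    using that E_sub by (auto simp: in_nbrs_def out_nbrs_def)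
  have rho: "rho (int n) l j = (\<Sum>t<n. if ik t = j then A l j *\<^sub>R zh t else 0)"
    if l: "l \<in> out_nbrs V E j" for n l j
  proof (induction n)
    case 0 then show ?case using rho0[of 0 l j] edge[OF l] by simp
  next
    case (Suc n)
    have "rho (int n + 1) l j = rho (int n) l j + (if ik n = j then A l j *\<^sub>R zh n else 0)"
      using rho_upd[OF edge(1,2)[OF l], of n] l by auto
    then show ?case using Suc by (simp add: add.commute)
  qed
  have rho': "rho \<tau> l j = (\<Sum>t<k. if ik t = j \<and> int t < \<tau> then A l j *\<^sub>R zh t else 0)"
    if l: "l \<in> out_nbrs V E j" and \<tau>: "- int D \<le> \<tau>" "\<tau> \<le> int k" for l j \<tau> k
  proof (cases "\<tau> \<le> 0")
    case True
    then show ?thesis using rho0 \<tau> edge[OF l] by simp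
  next
    case False
    then obtain n where n: "\<tau> = int n" using nonneg_int_cases[of \<tau>] by auto
    have "rho \<tau> l j = (\<Sum>t<n. if ik t = j \<and> int t < \<tau> then A l j *\<^sub>R zh t else 0)"
      unfolding n rho[OF l] by (intro sum.cong) auto
    also have "\<dots> = (\<Sum>t<k. if ik t = j \<and> int t < \<tau> then A l j *\<^sub>R zh t else 0)"
      using \<tau> n by (intro sum.mono_neutral_left) auto
    finally show ?thesis .
  qed
  have tau_rho: "rho (tau k (ik k) j) (ik k) j
      = (\<Sum>t<k. if ik t = j \<and> reception (ik k) t \<le> k then A (ik k) j *\<^sub>R zh t else 0)"
    if l: "ik k \<in> out_nbrs V E j" for j k
  proof -
    have "rho (tau k (ik k) j) (ik k) j
      = (\<Sum>t<k. if ik t = j \<and> int t < tau k (ik k) j then A (ik k) j *\<^sub>R zh t else 0)"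
      using edge[OF l] tau_ge tau_le by (intro rho' l) auto
    also have "\<dots> = (\<Sum>t<k. if ik t = j \<and> reception (ik k) t \<le> k then A (ik k) j *\<^sub>R zh t else 0)"
      using reception_le_iff[of k] l by (intro sum.cong) auto
    finally show ?thesis .
  qed
  have rhot: "rhot n l j = (\<Sum>t<n. if ik t = j \<and> reception l t < n then A l j *\<^sub>R zh t else 0)"
    if l: "l \<in> out_nbrs V E j" for n l j
  proof (induction n)
    case 0 then show ?case using rhot0 edge[OF l] by simp
  next
    case (Suc n)
    \<comment> \<open>The message of iteration \<open>n\<close> is received after \<open>n\<close>,
      so the last summand vanishes.\<close>
    have new: "(\<Sum>t<Suc n. if ik t = j \<and> reception l t < Suc n then A l j *\<^sub>R zh t else 0)
        = (\<Sum>t<n. if ik t = j \<and> reception l t \<le> n then A l j *\<^sub>R zh t else 0)"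
      using reception(3)[of l n] l by (auto simp: less_Suc_eq_le)
    show ?case
    proof (cases "l = ik n")
      case True
      have "rhot (Suc n) l j = rho (tau n l j) l j" using rhot_upd[OF edge(1,2)[OF l], of n] edge[OF l] True by simp
      then show ?thesis unfolding new using tau_rho[of n j] l unfolding True[symmetric] by simp
    next
      case False
      have "(\<Sum>t<n. if ik t = j \<and> reception l t \<le> n then A l j *\<^sub>R zh t else 0)
          = (\<Sum>t<n. if ik t = j \<and> reception l t < n then A l j *\<^sub>R zh t else 0)"
        using reception(1)[of l] l False by (intro sum.cong) (auto simp: le_less)
      then show ?thesis unfolding new using rhot_upd[OF edge(1,2)[OF l], of n] False Suc by simp
    qed
  qed
  have "(\<Sum>j\<in>in_nbrs V E (ik k). rho (tau k (ik k) j) (ik k) j - rhot k (ik k) j)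
      = (\<Sum>j\<in>in_nbrs V E (ik k). \<Sum>t<k. if ik t = j \<and> reception (ik k) t = k then A (ik k) (ik t) *\<^sub>R zh t else 0)"
  proof (intro sum.cong refl)
    fix j assume "j \<in> in_nbrs V E (ik k)"
    then have l: "ik k \<in> out_nbrs V E j" using ik_V by (auto simp: in_nbrs_def out_nbrs_def)
    show "rho (tau k (ik k) j) (ik k) j - rhot k (ik k) j
      = (\<Sum>t<k. if ik t = j \<and> reception (ik k) t = k then A (ik k) (ik t) *\<^sub>R zh t else 0)"
      unfolding tau_rho[OF l] rhot[OF l] sum_subtractf[symmetric] by (intro sum.cong) auto
  qed
  also have "\<dots> = (\<Sum>t<k. \<Sum>j\<in>in_nbrs V E (ik k). if ik t = j then
      (if reception (ik k) t = k then A (ik k) (ik t) *\<^sub>R zh t else 0) else 0)"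
    by (subst sum.swap) (auto intro!: sum.cong)
  also have "\<dots> = (\<Sum>t<k. if ik k \<in> out_nbrs V E (ik t) \<and> reception (ik k) t = k then A (ik k) (ik t) *\<^sub>R zh t else 0)"
    using finite_V ik_V by (intro sum.cong refl) (auto simp: in_nbrs_def out_nbrs_def)
  finally show ?thesis .
qed

text \<open>The numbers \<open>b s j\<close> are the shares of a unit mass held by agent \<open>j\<close> at time \<open>s\<close> that end up
  at the chosen agent at time \<open>k\<close>.  The total share-weighted mass, in the agents and in transit,
  only changes through the inputs \<open>\<Delta>\<close>.\<close>
lemma mass_representation:
  fixes z :: "nat \<Rightarrow> nat \<Rightarrow> 'a::real_vector"
  assumes zh: "\<And>k. zh k = z k (ik k)
      + (\<Sum>t<k. if ik k \<in> out_nbrs V E (ik t) \<and> reception (ik k) t = k then A (ik k) (ik t) *\<^sub>R zh t else 0) + \<Delta> k"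
    and z_upd: "\<And>k i. i \<in> V \<Longrightarrow> z (Suc k) i = (if i = ik k then A i i *\<^sub>R zh k else z k i)"
    and b_end: "\<And>j. j \<in> V \<Longrightarrow> b k j = (if j = i0 then 1 else 0)" and i0: "i0 \<in> V"
    and b_step: "\<And>s j. s < k \<Longrightarrow> j \<in> V \<Longrightarrow> b s j = (if j = ik s
      then A j j * b (Suc s) j + (\<Sum>l\<in>out_nbrs V E j. A l j * (if reception l s < k then b (reception l s) l else 0))
      else b (Suc s) j)"
  shows "z k i0 = (\<Sum>j\<in>V. b 0 j *\<^sub>R z 0 j) + (\<Sum>s<k. b s (ik s) *\<^sub>R \<Delta> s)"
proof -
  \<comment> \<open>A message received in iteration \<open>k\<close> or later cannot be contained in
    \<open>z k i0\<close>, so its share is 0.\<close>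
  define w where "w t l = (if reception l t < k then b (reception l t) l else 0)" for t l
  define mass where "mass P t = (\<Sum>l\<in>out_nbrs V E (ik t). if P (reception l t) then (A l (ik t) * w t l) *\<^sub>R zh t else 0)"
    for P t
  define val where "val s = (\<Sum>j\<in>V. b s j *\<^sub>R z s j) + (\<Sum>t<s. mass (\<lambda>r. s \<le> r) t)" for s
  have step: "val (Suc s) = val s + b s (ik s) *\<^sub>R \<Delta> s" if s: "s < k" for s
  proof -
    define i where "i = ik s"
    have i: "i \<in> V" using ik_V i_def by simp
    define rcv where "rcv = (\<Sum>t<s. if i \<in> out_nbrs V E (ik t) \<and> reception i t = s then A i (ik t) *\<^sub>R zh t else 0)"
    define rest where "rest = (\<Sum>j\<in>V - {i}. b s j *\<^sub>R z s j)"
    have z1: "(\<Sum>j\<in>V. b s j *\<^sub>R z s j) = b s i *\<^sub>R z s i + rest"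
      unfolding rest_def using finite_V i by (rule sum.remove)
    have "(\<Sum>j\<in>V. b (Suc s) j *\<^sub>R z (Suc s) j)
        = b (Suc s) i *\<^sub>R z (Suc s) i + (\<Sum>j\<in>V - {i}. b (Suc s) j *\<^sub>R z (Suc s) j)"
      using finite_V i by (rule sum.remove)
    also have "(\<Sum>j\<in>V - {i}. b (Suc s) j *\<^sub>R z (Suc s) j) = rest"
      unfolding rest_def using b_step[OF s] z_upd[of _ s] by (intro sum.cong) (auto simp: i_def)
    finally have z2: "(\<Sum>j\<in>V. b (Suc s) j *\<^sub>R z (Suc s) j) = (A i i * b (Suc s) i) *\<^sub>R zh s + rest"
      using z_upd[OF i, of s] by (simp add: i_def mult.commute)
    have m1: "mass (\<lambda>r. Suc s \<le> r) s = (\<Sum>l\<in>out_nbrs V E i. A l i * w s l) *\<^sub>R zh s"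
      unfolding mass_def scaleR_sum_left i_def using reception(3)[of _ s]
      by (intro sum.cong) (auto simp: Suc_le_eq)
    \<comment> \<open>Messages leaving transit at \<open>s\<close> are addressed to the active
      agent, because \<open>reception\<close> is always an activation of the receiver; hence they
      carry the share \<open>b s i\<close>.\<close>
    have m2: "mass (\<lambda>r. s \<le> r) t = mass (\<lambda>r. Suc s \<le> r) t
        + b s i *\<^sub>R (if i \<in> out_nbrs V E (ik t) \<and> reception i t = s then A i (ik t) *\<^sub>R zh t else 0)" for t
    proof -
      have "mass (\<lambda>r. s \<le> r) t = mass (\<lambda>r. Suc s \<le> r) t + mass (\<lambda>r. r = s) t"
        unfolding mass_def sum.distrib[symmetric] by (intro sum.cong) auto
      also have "mass (\<lambda>r. r = s) t = (\<Sum>l\<in>out_nbrs V E (ik t). if l = i then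
          (if reception i t = s then (b s i * A i (ik t)) *\<^sub>R zh t else 0) else 0)"
        unfolding mass_def using reception(1)[of _ t] s
        by (intro sum.cong refl) (auto simp: i_def w_def mult.commute)
      also have "\<dots> = b s i *\<^sub>R (if i \<in> out_nbrs V E (ik t) \<and> reception i t = s then A i (ik t) *\<^sub>R zh t else 0)"
        using finite_V by (simp add: out_nbrs_def)
      finally show ?thesis .
    qed
    have m3: "(\<Sum>t<s. mass (\<lambda>r. s \<le> r) t) = (\<Sum>t<s. mass (\<lambda>r. Suc s \<le> r) t) + b s i *\<^sub>R rcv"
      unfolding m2 rcv_def by (simp only: sum.distrib scaleR_sum_right)
    have bs: "b s i = A i i * b (Suc s) i + (\<Sum>l\<in>out_nbrs V E i. A l i * w s l)"
      using b_step[OF s i] by (simp add: i_def w_def)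
    have "val (Suc s) = b s i *\<^sub>R zh s + rest + (\<Sum>t<s. mass (\<lambda>r. Suc s \<le> r) t)"
      unfolding val_def z2 by (simp add: m1 bs scaleR_add_left)
    moreover have "zh s = z s i + rcv + \<Delta> s" unfolding rcv_def i_def by (rule zh)
    ultimately show ?thesis unfolding val_def z1 m3 i_def[symmetric] by (simp add: scaleR_add_right)
  qed
  have "s \<le> k \<Longrightarrow> val s = val 0 + (\<Sum>t<s. b t (ik t) *\<^sub>R \<Delta> t)" for s
    by (induction s) (simp_all add: step)
  moreover have "val k = z k i0"
  proof -
    have "(\<Sum>j\<in>V. b k j *\<^sub>R z k j) = (\<Sum>j\<in>V. if j = i0 then z k j else 0)"
      using b_end by (intro sum.cong) auto
    moreover have "mass (\<lambda>r. k \<le> r) t = 0" for t unfolding mass_def by (intro sum.neutral) (auto simp: w_def)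
    ultimately show ?thesis unfolding val_def using finite_V i0 by simp
  qed
  ultimately show ?thesis by (simp add: val_def)
qed

text \<open>Seen from time \<open>k\<close>, the shares at distant past times have nearly merged
  into one value \<open>\<xi>\<close>. So only the plain total of the injected mass matters, apart
  from what was injected recently.\<close>

theorem tracking_error:
  fixes z :: "nat \<Rightarrow> nat \<Rightarrow> 'a::real_normed_vector"
  assumes m: "0 < m" "m < 1" and adm: "admissible_weights V E m A" and col: "column_stochastic V A"
    and zh: "\<And>k. zh k = z k (ik k)
      + (\<Sum>t<k. if ik k \<in> out_nbrs V E (ik t) \<and> reception (ik k) t = k then A (ik k) (ik t) *\<^sub>R zh t else 0) + \<Delta> k"
    and z_upd: "\<And>k i. i \<in> V \<Longrightarrow> z (Suc k) i = (if i = ik k then A i i *\<^sub>R zh k else z k i)"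
  shows "\<exists>\<kappa> c \<eta> N. (\<forall>n. 0 \<le> \<kappa> n) \<and> summable \<kappa> \<and> (\<forall>n. 0 \<le> c n) \<and> summable c \<and> 0 < \<eta> \<and>
    (\<forall>k. \<forall>i\<in>V. \<exists>\<xi>. 0 \<le> \<xi> \<and> \<xi> \<le> 1 \<and> (N \<le> k \<longrightarrow> \<eta> \<le> \<xi>) \<and>
       norm (z k i - \<xi> *\<^sub>R ((\<Sum>j\<in>V. z 0 j) + (\<Sum>s<k. \<Delta> s))) \<le> c k + (\<Sum>s<k. \<kappa> (k - s) * norm (\<Delta> s)))"
proof -
  interpret averaging_graph V "out_nbrs V E" "\<lambda>i l. A l i" m by (rule averaging_graph_columns[OF m adm col])
  show ?thesis
  proof (rule impulse_response[of "D + T + 1" T])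
    fix \<kappa> :: "nat \<Rightarrow> real" and \<eta> :: real and N :: nat
    assume \<kappa>: "\<And>n. 0 \<le> \<kappa> n" "summable \<kappa>" and \<eta>: "0 < \<eta>"
      and B: "\<And>K act src u q i n j. schedule T (D + T + 1) K act src \<Longrightarrow> solves K q act src u \<Longrightarrow> impulse q i u \<Longrightarrow>
        i \<in> V \<Longrightarrow> n \<le> K \<Longrightarrow> j \<in> V \<Longrightarrow> 0 \<le> u n j \<and> u n j \<le> 1"
      and P: "\<And>K act src u q i n j. schedule T (D + T + 1) K act src \<Longrightarrow> solves K q act src u \<Longrightarrow> impulse q i u \<Longrightarrow>
        i \<in> V \<Longrightarrow> n \<le> K \<Longrightarrow> q + N \<le> n \<Longrightarrow> j \<in> V \<Longrightarrow> \<eta> \<le> u n j"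
      and C: "\<And>K act src u q i n k j j'. schedule T (D + T + 1) K act src \<Longrightarrow> solves K q act src u \<Longrightarrow> impulse q i u \<Longrightarrow>
        i \<in> V \<Longrightarrow> q \<le> n \<Longrightarrow> n \<le> k \<Longrightarrow> k \<le> K \<Longrightarrow> j \<in> V \<Longrightarrow> j' \<in> V \<Longrightarrow> \<bar>u k j' - u n j\<bar> \<le> \<kappa> (n - q)"
    define c where "c k = \<kappa> k * (\<Sum>j\<in>V. norm (z 0 j))" for k
    have main: "\<exists>\<xi>. 0 \<le> \<xi> \<and> \<xi> \<le> 1 \<and> (N \<le> k \<longrightarrow> \<eta> \<le> \<xi>) \<and>
       norm (z k i0 - \<xi> *\<^sub>R ((\<Sum>j\<in>V. z 0 j) + (\<Sum>s<k. \<Delta> s))) \<le> c k + (\<Sum>s<k. \<kappa> (k - s) * norm (\<Delta> s))"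
      if i0: "i0 \<in> V" for k i0
    proof -
      text \<open>Shares are computed backwards in time: index \<open>n\<close> stands for time \<open>k + 1 - n\<close>.\<close>
      define act where "act n = ik (k - n)" for n
      \<comment> \<open>Index 0 lies beyond time \<open>k\<close>; the impulse starting at index 1
        vanishes there, as messages that arrive too late require. The delay stays bounded, since
        such messages were sent at most \<open>D + T\<close> before \<open>k\<close>.\<close>
      define src where "src n l = (if reception l (k - n) < k then k + 1 - reception l (k - n) else 0)" for n l
      have src: "src n l \<le> n \<and> n \<le> src n l + (D + T + 1)" if "n < k + 1" "l \<in> out_nbrs V E (act n)" for n l
        using reception(3,4)[of l "k - n"] that unfolding act_def src_def by auto
      have sch: "schedule T (D + T + 1) (k + 1) act src"
        unfolding schedule_def
      proof (intro conjI allI impI ballI)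
        fix n i assume n: "n + T \<le> k + 1" and "i \<in> V"
        then obtain t where t: "k + 1 - n - T \<le> t" "t < k + 1 - n - T + T" "ik t = i" using ik_T by blast
        then show "\<exists>t\<ge>n. t < n + T \<and> act t = i"
          by (intro exI[of _ "k - t"]) (use n in \<open>auto simp: act_def\<close>)
      qed (use ik_V src in \<open>auto simp: act_def\<close>)
      obtain u where imp: "impulse 1 i0 u" and sol: "solves (k + 1) 1 act src u"
        using ex_impulse_solution[of 1 i0 act src] src by blast
      define b where "b s j = u (k + 1 - s) j" for s j
      \<comment> \<open>The share of \<open>i0\<close> at time 0 serves as reference; any agent
        would do, as the oscillation bound compares all of them with the shares at later
        times.\<close>
      define \<xi> where "\<xi> = b 0 i0"
      have rep: "z k i0 = (\<Sum>j\<in>V. b 0 j *\<^sub>R z 0 j) + (\<Sum>s<k. b s (ik s) *\<^sub>R \<Delta> s)"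
      proof (rule mass_representation[OF zh z_upd _ i0])
        show "b k j = (if j = i0 then 1 else 0)" if "j \<in> V" for j
          using imp that by (simp add: b_def impulse_def)
        fix s j assume s: "s < k" and j: "j \<in> V"
        define n where "n = k - s"
        have n: "1 \<le> n" "n < k + 1" "k - n = s" "k + 1 - s = Suc n" "k + 1 - Suc s = n" using s by (auto simp: n_def)
        have "b s j = delayed_average (out_nbrs V E) (\<lambda>i l. A l i) act src n u j"
          using sol n j unfolding solves_def b_def by simp
        moreover have "u (src n l) l = (if reception l s < k then b (reception l s) l else 0)"
          if "l \<in> out_nbrs V E j" for l
          using imp that unfolding src_def n(3) b_def impulse_def by (auto simp: out_nbrs_def)
        ultimately show "b s j = (if j = ik s
          then A j j * b (Suc s) j + (\<Sum>l\<in>out_nbrs V E j. A l j * (if reception l s < k then b (reception l s) l else 0))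
          else b (Suc s) j)"
          using n by (simp add: delayed_average_def act_def b_def)
      qed
      have dev: "\<bar>b s j - \<xi>\<bar> \<le> \<kappa> (k - s)" if "s \<le> k" "j \<in> V" for s j
        using C[OF sch sol imp i0, of "k + 1 - s" "k + 1" j i0] that i0
        unfolding \<xi>_def b_def by (simp add: abs_minus_commute Suc_diff_le)
      have "z k i0 - \<xi> *\<^sub>R ((\<Sum>j\<in>V. z 0 j) + (\<Sum>s<k. \<Delta> s))
        = (\<Sum>j\<in>V. (b 0 j - \<xi>) *\<^sub>R z 0 j) + (\<Sum>s<k. (b s (ik s) - \<xi>) *\<^sub>R \<Delta> s)"
        unfolding rep by (simp add: scaleR_diff_left sum_subtractf scaleR_add_right scaleR_sum_right)
      also have "norm \<dots> \<le> (\<Sum>j\<in>V. \<kappa> k * norm (z 0 j)) + (\<Sum>s<k. \<kappa> (k - s) * norm (\<Delta> s))"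
      proof (rule order_trans[OF norm_triangle_ineq], intro add_mono sum_norm_le)
        show "norm ((b 0 j - \<xi>) *\<^sub>R z 0 j) \<le> \<kappa> k * norm (z 0 j)" if "j \<in> V" for j
          using dev[of 0 j] that by (simp add: mult_right_mono)
        show "norm ((b s (ik s) - \<xi>) *\<^sub>R \<Delta> s) \<le> \<kappa> (k - s) * norm (\<Delta> s)" if "s \<in> {..<k}" for s
          using dev[of s "ik s"] that ik_V by (simp add: mult_right_mono)
      qed
      finally have "norm (z k i0 - \<xi> *\<^sub>R ((\<Sum>j\<in>V. z 0 j) + (\<Sum>s<k. \<Delta> s)))
        \<le> c k + (\<Sum>s<k. \<kappa> (k - s) * norm (\<Delta> s))" by (simp add: c_def sum_distrib_left)
      moreover have "0 \<le> \<xi>" "\<xi> \<le> 1" "N \<le> k \<longrightarrow> \<eta> \<le> \<xi>"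
        using B[OF sch sol imp i0, of "k + 1" i0] P[OF sch sol imp i0, of "k + 1" i0] i0
        unfolding \<xi>_def b_def by auto
      ultimately show ?thesis by blast
    qed
    have cs: "summable c" "\<forall>n. 0 \<le> c n"
      unfolding c_def using \<kappa> by (auto intro!: summable_mult2 mult_nonneg_nonneg sum_nonneg)
    show ?thesis
      by (rule exI[of _ \<kappa>], rule exI[of _ c], rule exI[of _ \<eta>], rule exI[of _ N], intro conjI)
        (use \<kappa> \<eta> cs main in blast)+
  qed simp
qed

section \<open>Local step sizes\<close>

lemma card_activations_ge:
  assumes i: "i \<in> V"
  shows "n * T \<le> k \<Longrightarrow> n \<le> card {t. t < k \<and> ik t = i}"
proof (induction n arbitrary: k)
  case (Suc n)
  obtain t where t: "n * T \<le> t" "t < n * T + T" "ik t = i" using ik_T[OF i] by blast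
  have "Suc n \<le> card (insert t {s. s < n * T \<and> ik s = i})" using Suc.IH[of "n * T"] t by (subst card_insert_disjoint) auto
  also have "\<dots> \<le> card {t. t < k \<and> ik t = i}" using t Suc.prems by (intro card_mono) auto
  finally show ?case .
qed simp

text \<open>The agent active at an iteration \<open>k \<ge> n * T\<close> has had at least
  \<open>n\<close> earlier activations, so its step size is at most
  \<open>\<alpha> n\<close>.\<close>

lemma local_stepsize_tendsto_0:
  assumes dec: "decseq \<alpha>" and lim: "\<alpha> \<longlonglongrightarrow> 0"
  shows "local_stepsize \<alpha> ik \<longlonglongrightarrow> 0" and "0 \<le> local_stepsize \<alpha> ik k"
proof -
  have \<alpha>0: "0 \<le> \<alpha> n" for n using decseq_ge[OF dec lim] .
  then show "0 \<le> local_stepsize \<alpha> ik k" by (simp add: local_stepsize_def)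
  show "local_stepsize \<alpha> ik \<longlonglongrightarrow> 0"
  proof (rule LIMSEQ_I)
    fix r :: real assume "0 < r"
    then have "eventually (\<lambda>n. \<alpha> n < r) sequentially" using lim by (intro order_tendstoD(2))
    then obtain n where n: "\<alpha> n < r" unfolding eventually_sequentially by blast
    have "norm (local_stepsize \<alpha> ik k - 0) < r" if "n * T \<le> k" for k
    proof -
      have "n \<le> activation_count ik k" unfolding activation_count_def using card_activations_ge[OF ik_V that] .
      then have "\<alpha> (activation_count ik k) \<le> \<alpha> n" using dec by (simp add: decseq_def)
      then show ?thesis using n \<alpha>0 by (simp add: local_stepsize_def)
    qed
    then show "\<exists>no. \<forall>n\<ge>no. norm (local_stepsize \<alpha> ik n - 0) < r" by blast
  qed
qed

end

section \<open>Descent and the merit function\<close>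

lemma GDERIV_sum:
  assumes "\<And>i. i \<in> A \<Longrightarrow> GDERIV (f i) y :> g i"
  shows "GDERIV (\<lambda>y. \<Sum>i\<in>A. f i y) y :> (\<Sum>i\<in>A. g i)"
  using assms unfolding gderiv_def inner_sum_right by (intro has_derivative_sum)

text \<open>The mean value theorem on the segment yields the constant \<open>L\<close> in place of
  the sharp \<open>L / 2\<close>, which is enough for the small-gain estimate.\<close>

lemma descent_lemma:
  fixes F :: "'a::real_inner \<Rightarrow> real"
  assumes grad: "\<And>y. GDERIV F y :> G y"
    and lip: "\<And>y y'. norm (G y - G y') \<le> L * norm (y - y')" and L: "0 \<le> L"
  shows "F (y + h) \<le> F y + G y \<bullet> h + L * (norm h)\<^sup>2"
proof -
  have der: "DERIV (\<lambda>t. F (y + t *\<^sub>R h)) t :> h \<bullet> G (y + t *\<^sub>R h)" for t :: real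
  proof -
    have "((\<lambda>t. y + t *\<^sub>R h) has_derivative (\<lambda>s. s *\<^sub>R h)) (at t)"
      by (auto intro!: derivative_eq_intros)
    from diff_chain_at[OF this grad[unfolded gderiv_def]]
    have "((\<lambda>t. F (y + t *\<^sub>R h)) has_derivative (\<lambda>s. (s *\<^sub>R h) \<bullet> G (y + t *\<^sub>R h))) (at t)"
      by (simp add: o_def)
    then show ?thesis by (rule has_derivative_imp_has_field_derivative) simp
  qed
  obtain \<theta> :: real where \<theta>: "0 < \<theta>" "\<theta> < 1"
    and eq: "F (y + 1 *\<^sub>R h) - F (y + 0 *\<^sub>R h) = (1 - 0) * (h \<bullet> G (y + \<theta> *\<^sub>R h))"
    using MVT2[of 0 1 "\<lambda>t. F (y + t *\<^sub>R h)" "\<lambda>t. h \<bullet> G (y + t *\<^sub>R h)"] der by auto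
  have "h \<bullet> (G (y + \<theta> *\<^sub>R h) - G y) \<le> norm h * norm (G (y + \<theta> *\<^sub>R h) - G y)"
    by (rule norm_cauchy_schwarz)
  also have "\<dots> \<le> norm h * (L * norm h)"
  proof (rule mult_left_mono)
    have "norm (G (y + \<theta> *\<^sub>R h) - G y) \<le> L * norm (\<theta> *\<^sub>R h)" using lip[of "y + \<theta> *\<^sub>R h" y] by simp
    also have "\<dots> \<le> L * norm h" using \<theta> L by (intro mult_left_mono) (auto simp: mult_left_le_one_le)
    finally show "norm (G (y + \<theta> *\<^sub>R h) - G y) \<le> L * norm h" .
  qed simp
  finally show ?thesis using eq by (simp add: inner_diff_right inner_commute power2_eq_square algebra_simps)
qed

text \<open>While \<open>M\<close> stays above \<open>\<delta>\<close>, the weighted sum is at least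
  \<open>\<delta>\<close> times the sum of the step sizes. Adding 1 to \<open>\<bar>C\<bar>\<close>
  makes the constant positive and strictly larger than \<open>C\<close>, which gives the
  contradiction.\<close>

lemma first_time_le_weighted_sum:
  fixes \<gamma> M :: "nat \<Rightarrow> real"
  assumes \<gamma>: "\<And>k. 0 \<le> \<gamma> k" and C: "\<And>n. (\<Sum>k<n. \<gamma> k * M k) \<le> C"
  shows "\<exists>c>0. \<forall>\<delta>>0. first_time (\<lambda>k. M k \<le> \<delta>) \<le> Inf (enat ` {k. c / \<delta> \<le> (\<Sum>t\<le>k. \<gamma> t)})"
proof (intro exI[of _ "\<bar>C\<bar> + 1"] conjI allI impI)
  fix \<delta> :: real assume \<delta>: "0 < \<delta>"
  show "first_time (\<lambda>k. M k \<le> \<delta>) \<le> Inf (enat ` {k. (\<bar>C\<bar> + 1) / \<delta> \<le> (\<Sum>t\<le>k. \<gamma> t)})"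
  proof (rule Inf_greatest)
    fix e assume "e \<in> enat ` {k. (\<bar>C\<bar> + 1) / \<delta> \<le> (\<Sum>t\<le>k. \<gamma> t)}"
    then obtain k where e: "e = enat k" and k: "(\<bar>C\<bar> + 1) / \<delta> \<le> (\<Sum>t\<le>k. \<gamma> t)" by auto
    have "\<exists>j\<le>k. M j \<le> \<delta>"
    proof (rule ccontr)
      assume "\<not> (\<exists>j\<le>k. M j \<le> \<delta>)"
      then have "\<delta> \<le> M t" if "t \<le> k" for t using that by (meson linear)
      then have "(\<Sum>t\<le>k. \<gamma> t * \<delta>) \<le> (\<Sum>t\<le>k. \<gamma> t * M t)"
        using \<gamma> by (intro sum_mono mult_left_mono) auto
      also have "\<dots> \<le> C" using C[of "Suc k"] by (simp add: lessThan_Suc_atMost)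
      finally have "(\<Sum>t\<le>k. \<gamma> t) * \<delta> \<le> C" by (simp add: sum_distrib_right)
      then show False using k \<delta> by (simp add: field_simps)
    qed
    then obtain j where j: "j \<le> k" "M j \<le> \<delta>" by blast
    have "first_time (\<lambda>k. M k \<le> \<delta>) \<le> enat j" unfolding first_time_def using j by (intro Inf_lower) auto
    also have "\<dots> \<le> e" using j e by simp
    finally show "first_time (\<lambda>k. M k \<le> \<delta>) \<le> e" .
  qed
qed simp

text \<open>The mean of the \<open>xs i\<close> is itself within \<open>U\<close> of
  \<open>y\<close>, so both parts of the merit function can be compared with quantities at
  \<open>y\<close>, which need not be the mean.\<close>

lemma merit_le:
  fixes g :: "nat \<Rightarrow> 'a::real_inner \<Rightarrow> 'a"
  assumes I: "1 \<le> I" and lip: "\<And>i y y'. i < I \<Longrightarrow> norm (g i y - g i y') \<le> L i * norm (y - y')"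
    and L: "\<And>i. 0 \<le> L i" and U: "\<And>i. i < I \<Longrightarrow> norm (xs i - y) \<le> U"
  shows "merit I g xs \<le> (2 + 2 * (\<Sum>i<I. L i)\<^sup>2 + 4 * real I) * ((norm (\<Sum>i<I. g i y))\<^sup>2 + U\<^sup>2)"
proof -
  define xb where "xb = (1 / real I) *\<^sub>R (\<Sum>i<I. xs i)"
  have U0: "0 \<le> U" using U[of 0] I norm_ge_zero[of "xs 0 - y"] by linarith
  have Ip: "0 < real I" using I by simp
  have "xb - y = (1 / real I) *\<^sub>R (\<Sum>i<I. xs i - y)"
    using Ip by (simp add: xb_def sum_subtractf scaleR_diff_right sum_constant_scaleR)
  moreover have "norm (\<Sum>i<I. xs i - y) \<le> real I * U" using sum_norm_le[of "{..<I}" "\<lambda>i. xs i - y" "\<lambda>_. U"] U by simp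
  ultimately have xb: "norm (xb - y) \<le> U" using Ip by (simp add: field_simps)
  have "norm ((\<Sum>i<I. g i xb) - (\<Sum>i<I. g i y)) \<le> (\<Sum>i<I. L i * U)"
    unfolding sum_subtractf[symmetric]
    using lip xb L by (intro sum_norm_le) (meson lessThan_iff mult_left_mono order_trans)
  then have "norm (\<Sum>i<I. g i xb) \<le> norm (\<Sum>i<I. g i y) + (\<Sum>i<I. L i) * U"
    unfolding sum_distrib_right[symmetric] using norm_triangle_sub[of "\<Sum>i<I. g i xb" "\<Sum>i<I. g i y"] by linarith
  then have "(norm (\<Sum>i<I. g i xb))\<^sup>2 \<le> (norm (\<Sum>i<I. g i y) + (\<Sum>i<I. L i) * U)\<^sup>2" by (intro power_mono) auto
  also have "\<dots> \<le> 2 * ((norm (\<Sum>i<I. g i y))\<^sup>2 + ((\<Sum>i<I. L i) * U)\<^sup>2)" by (rule power2_sum2_le)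
  finally have 1: "(norm (\<Sum>i<I. g i xb))\<^sup>2 \<le> 2 * (norm (\<Sum>i<I. g i y))\<^sup>2 + 2 * (\<Sum>i<I. L i)\<^sup>2 * U\<^sup>2"
    by (simp add: power_mult_distrib)
  have "(norm (xs i - xb))\<^sup>2 \<le> 4 * U\<^sup>2" if "i < I" for i
  proof -
    have "norm (xs i - xb) \<le> norm (xs i - y) + norm (xb - y)" using norm_triangle_ineq4[of "xs i - y" "xb - y"] by simp
    then have "norm (xs i - xb) \<le> 2 * U" using U[OF that] xb by linarith
    then have "(norm (xs i - xb))\<^sup>2 \<le> (2 * U)\<^sup>2" by (intro power_mono) auto
    then show ?thesis by (simp add: power_mult_distrib)
  qed
  then have 2: "(\<Sum>i<I. (norm (xs i - xb))\<^sup>2) \<le> 4 * real I * U\<^sup>2"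
    using sum_mono[of "{..<I}" "\<lambda>i. (norm (xs i - xb))\<^sup>2" "\<lambda>_. 4 * U\<^sup>2"] by simp
  define N where "N = (norm (\<Sum>i<I. g i y))\<^sup>2"
  have N: "0 \<le> N" "0 \<le> U\<^sup>2" "0 \<le> (\<Sum>i<I. L i)\<^sup>2" unfolding N_def by auto
  have nn: "0 \<le> (\<Sum>i<I. L i)\<^sup>2 * N" "0 \<le> real I * N" "0 \<le> (\<Sum>i<I. L i)\<^sup>2 * U\<^sup>2" "0 \<le> real I * U\<^sup>2" using N by simp_all
  have "merit I g xs \<le> 2 * N + 2 * (\<Sum>i<I. L i)\<^sup>2 * U\<^sup>2 + 4 * real I * U\<^sup>2"
    unfolding merit_def Let_def xb_def[symmetric] using 1 2 nn N unfolding N_def[symmetric]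
    by (intro max.boundedI) linarith+
  also have "\<dots> \<le> (2 + 2 * (\<Sum>i<I. L i)\<^sup>2 + 4 * real I) * (N + U\<^sup>2)"
    using nn N by (simp add: algebra_simps)
  finally show ?thesis unfolding N_def .
qed

theorem theorem4:
  fixes I :: nat
    and f :: "nat \<Rightarrow> 'a::euclidean_space \<Rightarrow> real"
    and g :: "nat \<Rightarrow> 'a \<Rightarrow> 'a"
    and L :: "nat \<Rightarrow> real"
    and E :: "(nat \<times> nat) set"
    and W A :: "nat \<Rightarrow> nat \<Rightarrow> real"
    and mbar :: real
    and ik :: "nat \<Rightarrow> nat"
    and d :: "nat \<Rightarrow> nat \<Rightarrow> nat"
    and T D :: nat
    and \<alpha> :: "nat \<Rightarrow> real"
    and x z :: "nat \<Rightarrow> nat \<Rightarrow> 'a"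
    and zh :: "nat \<Rightarrow> 'a"
    and v :: "int \<Rightarrow> nat \<Rightarrow> 'a"
    and rho :: "int \<Rightarrow> nat \<Rightarrow> nat \<Rightarrow> 'a"
    and rhot :: "nat \<Rightarrow> nat \<Rightarrow> nat \<Rightarrow> 'a"
    and tau :: "nat \<Rightarrow> nat \<Rightarrow> nat \<Rightarrow> int"
  defines "V \<equiv> {..<I}"
  assumes I_pos: "1 \<le> I"
    (* problem *)
    and grad: "\<forall>i\<in>V. \<forall>y. GDERIV (f i) y :> g i y"
    and lip: "\<forall>i\<in>V. \<forall>y y'. norm (g i y - g i y') \<le> L i * norm (y - y')"
    and bdd: "\<exists>B. \<forall>y. B \<le> (\<Sum>i\<in>V. f i y)"
    (* graph *)
    and E_sub: "E \<subseteq> V \<times> V"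
    and E_irrefl: "\<forall>i. (i, i) \<notin> E"
    and E_strong: "\<forall>i\<in>V. \<forall>j\<in>V. (i, j) \<in> E\<^sup>*"
    (* weights *)
    and mbar: "0 < mbar" "mbar < 1"
    and W_adm: "admissible_weights V E mbar W" and W_row: "row_stochastic V W"
    and A_adm: "admissible_weights V E mbar A" and A_col: "column_stochastic V A"
    (* asynchrony *)
    and ik_V: "\<forall>k. ik k \<in> V"
    and ik_T: "\<forall>k. \<forall>i\<in>V. \<exists>t. k \<le> t \<and> t < k + T \<and> ik t = i"
    and d_D: "\<forall>k. \<forall>j\<in>in_nbrs V E (ik k). d k j \<le> D"
    (* step sizes *)
    and \<alpha>_dec: "decseq \<alpha>" and \<alpha>_lim: "\<alpha> \<longlonglongrightarrow> 0" and \<alpha>_div: "\<not> summable \<alpha>"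
    (* initialization *)
    and z0: "\<forall>i\<in>V. z 0 i = g i (x 0 i)"
    and rhot0: "\<forall>i\<in>V. \<forall>j\<in>V. rhot 0 i j = 0"
    and v0: "\<forall>t. - int D \<le> t \<and> t \<le> 0 \<longrightarrow> (\<forall>i\<in>V. v t i = 0)"
    and rho0: "\<forall>t. - int D \<le> t \<and> t \<le> 0 \<longrightarrow> (\<forall>i\<in>V. \<forall>j\<in>V. rho t i j = 0)"
    (* iteration k, active agent ik k *)
    and tau_upd: "\<forall>k. \<forall>i\<in>V. \<forall>j\<in>in_nbrs V E i.
        tau k i j = (let p = (if k = 0 then - int D else tau (k - 1) i j)
                     in if i = ik k then max p (int k - int (d k j)) else p)"
    and v_upd: "\<forall>k. \<forall>i\<in>V. v (int k + 1) i =
        (if i = ik k then x k i - local_stepsize \<alpha> ik k *\<^sub>R z k i else v (int k) i)"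
    and x_upd: "\<forall>k. \<forall>i\<in>V. x (Suc k) i =
        (if i = ik k then W i i *\<^sub>R v (int k + 1) i
              + (\<Sum>j\<in>in_nbrs V E i. W i j *\<^sub>R v (tau k i j) j)
         else x k i)"
    and zh_def: "\<forall>k. zh k = z k (ik k)
        + (\<Sum>j\<in>in_nbrs V E (ik k). rho (tau k (ik k) j) (ik k) j - rhot k (ik k) j)
        + g (ik k) (x (Suc k) (ik k)) - g (ik k) (x k (ik k))"
    and z_upd: "\<forall>k. \<forall>i\<in>V. z (Suc k) i = (if i = ik k then A i i *\<^sub>R zh k else z k i)"
    and rho_upd: "\<forall>k. \<forall>j\<in>V. \<forall>i\<in>V. rho (int k + 1) j i =
        (if i = ik k \<and> j \<in> out_nbrs V E i then rho (int k) j i + A j i *\<^sub>R zh k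
         else rho (int k) j i)"
    and rhot_upd: "\<forall>k. \<forall>i\<in>V. \<forall>j\<in>V. rhot (Suc k) i j =
        (if i = ik k \<and> j \<in> in_nbrs V E i then rho (tau k i j) i j else rhot k i j)"
  shows "\<exists>c>0. \<forall>\<delta>>0.
    first_time (\<lambda>k. merit I g (x k) \<le> \<delta>)
      \<le> Inf (enat ` {k. c / \<delta> \<le> (\<Sum>t\<le>k. local_stepsize \<alpha> ik t)})"
proof -
  have tau0: "tau 0 i j = (if i = ik 0 then max (- int D) (- int (d 0 j)) else - int D)"
    if "i \<in> V" "j \<in> in_nbrs V E i" for i j
    using tau_upd[rule_format, OF that, of 0] by simp
  have tauS: "tau (Suc k) i j = (if i = ik (Suc k) then max (tau k i j) (int (Suc k) - int (d (Suc k) j)) else tau k i j)"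
    if "i \<in> V" "j \<in> in_nbrs V E i" for i j k
    using tau_upd[rule_format, OF that, of "Suc k"] by simp
  interpret asynchronous_network V E ik T D tau
  proof
    have "0 \<in> V" using I_pos by (simp add: V_def)
    then show "V \<noteq> {}" by blast
    show "finite V" by (simp add: V_def)
    show "E \<subseteq> V \<times> V" by fact
    show "(i, i) \<notin> E" for i using E_irrefl by blast
    show "(i, j) \<in> E\<^sup>*" if "i \<in> V" "j \<in> V" for i j using E_strong that by blast
    show "ik k \<in> V" for k using ik_V by blast
    show "\<exists>t\<ge>k. t < k + T \<and> ik t = i" if "i \<in> V" for i k using ik_T that by blast
    show "- int D \<le> tau k i j" if "i \<in> V" "j \<in> in_nbrs V E i" for i j k
      by (induction k) (auto simp: tau0[OF that] tauS[OF that] le_max_iff_disj)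
    show "tau k i j \<le> int k" if "i \<in> V" "j \<in> in_nbrs V E i" for i j k
      by (induction k) (auto simp: tau0[OF that] tauS[OF that])
    show "int k - int D \<le> tau k (ik k) j" if j: "j \<in> in_nbrs V E (ik k)" for j k
    proof -
      have "d k j \<le> D" using d_D j by blast
      moreover have "int k - int (d k j) \<le> tau k (ik k) j"
        using tau_upd[rule_format, OF ik_V[rule_format] j, of k] by (simp add: Let_def)
      ultimately show ?thesis by linarith
    qed
    show "tau k i j \<le> tau k' i j" if "i \<in> V" "j \<in> in_nbrs V E i" "k \<le> k'" for i j k k'
      using that(3) by (rule lift_Suc_mono_le[rotated]) (simp add: tauS[OF that(1,2)])
  qed
  define \<gamma> where "\<gamma> = local_stepsize \<alpha> ik"
  have \<gamma>: "\<gamma> \<longlonglongrightarrow> 0" "\<And>k. 0 \<le> \<gamma> k"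
    unfolding \<gamma>_def using local_stepsize_tendsto_0[OF \<alpha>_dec \<alpha>_lim] by auto
  define p where "p k = - (\<gamma> k *\<^sub>R z k (ik k))" for k
  define \<Delta> where "\<Delta> k = g (ik k) (x (Suc k) (ik k)) - g (ik k) (x k (ik k))" for k
  define Lc where "Lc = (\<Sum>i\<in>V. \<bar>L i\<bar>)"
  have Lc: "0 \<le> Lc" unfolding Lc_def by (simp add: sum_nonneg)
  have lip': "norm (g i y - g i y') \<le> \<bar>L i\<bar> * norm (y - y')" if "i \<in> V" for i y y'
  proof -
    have "norm (g i y - g i y') \<le> L i * norm (y - y')" using lip that by blast
    also have "\<dots> \<le> \<bar>L i\<bar> * norm (y - y')" by (intro mult_right_mono) auto
    finally show ?thesis .
  qed
  have lip_sum: "norm ((\<Sum>i\<in>V. g i (a i)) - (\<Sum>i\<in>V. g i (b i))) \<le> Lc * u"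
    if "\<And>i. i \<in> V \<Longrightarrow> norm (a i - b i) \<le> u" for a b u
    unfolding Lc_def sum_subtractf[symmetric] sum_distrib_right
  proof (rule sum_norm_le)
    fix i assume i: "i \<in> V"
    have "norm (g i (a i) - g i (b i)) \<le> \<bar>L i\<bar> * norm (a i - b i)" using lip' i by blast
    also have "\<dots> \<le> \<bar>L i\<bar> * u" using that i by (intro mult_left_mono) auto
    finally show "norm (g i (a i) - g i (b i)) \<le> \<bar>L i\<bar> * u" .
  qed
  have lip_one: "norm (g i y - g i y') \<le> Lc * norm (y - y')" if "i \<in> V" for i y y'
  proof -
    have "\<bar>L i\<bar> \<le> Lc" unfolding Lc_def using finite_V that by (intro member_le_sum) auto
    then show ?thesis using lip'[OF that, of y y'] mult_right_mono[of "\<bar>L i\<bar>" Lc "norm (y - y')"] by simp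
  qed

  have v_upd': "v (int k + 1) i = (if i = ik k then x k i + p k else v (int k) i)" if "i \<in> V" for k i
    using v_upd that by (auto simp: p_def \<gamma>_def)
  have v0': "v t i = 0" if "- int D \<le> t" "t \<le> 0" "i \<in> V" for t i using v0 that by blast
  have "\<exists>\<kappa> c \<eta> \<psi> y. (\<forall>n. 0 \<le> \<kappa> n) \<and> summable \<kappa> \<and> (\<forall>n. 0 \<le> c n) \<and> summable c \<and> 0 < \<eta> \<and>
    (\<forall>k. \<eta> \<le> \<psi> k \<and> \<psi> k \<le> 1) \<and> (\<forall>k. y (Suc k) = y k + \<psi> k *\<^sub>R p k) \<and>
    (\<forall>k. \<forall>j\<in>V. norm (x k j - y k) \<le> c k + (\<Sum>s<k. \<kappa> (k - s) * norm (p s)))"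
    by (rule consensus_error[OF mbar W_adm W_row v0' v_upd' x_upd[rule_format]])
  then obtain \<kappa> c0 \<eta> \<psi> y where \<kappa>: "\<forall>n. 0 \<le> \<kappa> n" "summable \<kappa>" and c0: "\<forall>n. 0 \<le> c0 n" "summable c0"
    and \<eta>: "0 < \<eta>" and \<psi>: "\<forall>k. \<eta> \<le> \<psi> k \<and> \<psi> k \<le> 1" and y: "\<forall>k. y (Suc k) = y k + \<psi> k *\<^sub>R p k"
    and cons: "\<forall>k. \<forall>j\<in>V. norm (x k j - y k) \<le> c0 k + (\<Sum>s<k. \<kappa> (k - s) * norm (p s))"
    by (elim exE conjE) (rule that)

  have rcv: "(\<Sum>j\<in>in_nbrs V E (ik k). rho (tau k (ik k) j) (ik k) j - rhot k (ik k) j) =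
      (\<Sum>t<k. if ik k \<in> out_nbrs V E (ik t) \<and> reception (ik k) t = k then A (ik k) (ik t) *\<^sub>R zh t else 0)" for k
    by (rule received_mass[OF rho0[rule_format, OF conjI] rhot0[rule_format] rho_upd[rule_format] rhot_upd[rule_format]])
  have zh: "zh k = z k (ik k) + (\<Sum>t<k. if ik k \<in> out_nbrs V E (ik t) \<and> reception (ik k) t = k
      then A (ik k) (ik t) *\<^sub>R zh t else 0) + \<Delta> k" for k
    using zh_def[rule_format, of k] unfolding rcv by (simp add: \<Delta>_def)
  have "\<exists>\<kappa> c \<eta> N. (\<forall>n. 0 \<le> \<kappa> n) \<and> summable \<kappa> \<and> (\<forall>n. 0 \<le> c n) \<and> summable c \<and> 0 < \<eta> \<and>
    (\<forall>k. \<forall>i\<in>V. \<exists>\<xi>. 0 \<le> \<xi> \<and> \<xi> \<le> 1 \<and> (N \<le> k \<longrightarrow> \<eta> \<le> \<xi>) \<and>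
       norm (z k i - \<xi> *\<^sub>R ((\<Sum>j\<in>V. z 0 j) + (\<Sum>s<k. \<Delta> s))) \<le> c k + (\<Sum>s<k. \<kappa> (k - s) * norm (\<Delta> s)))"
    by (rule tracking_error[OF mbar A_adm A_col zh z_upd[rule_format]])
  then obtain \<kappa>' c1 \<eta>' N where \<kappa>': "\<forall>n. 0 \<le> \<kappa>' n" "summable \<kappa>'" and c1: "\<forall>n. 0 \<le> c1 n" "summable c1"
    and \<eta>': "0 < \<eta>'" and track: "\<forall>k. \<forall>i\<in>V. \<exists>\<xi>. 0 \<le> \<xi> \<and> \<xi> \<le> 1 \<and> (N \<le> k \<longrightarrow> \<eta>' \<le> \<xi>) \<and>
       norm (z k i - \<xi> *\<^sub>R ((\<Sum>j\<in>V. z 0 j) + (\<Sum>s<k. \<Delta> s))) \<le> c1 k + (\<Sum>s<k. \<kappa>' (k - s) * norm (\<Delta> s))"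
    by (elim exE conjE) (rule that)
  \<comment> \<open>Only the active agent moves, so the increments telescope. Starting from the
    local gradients, the injected mass always equals the sum of the gradients at the current
    iterates.\<close>
  have total: "(\<Sum>j\<in>V. z 0 j) + (\<Sum>s<k. \<Delta> s) = (\<Sum>j\<in>V. g j (x k j))" for k
  proof (induction k)
    case 0 then show ?case using z0 by (simp cong: sum.cong)
  next
    case (Suc k)
    have "(\<Sum>j\<in>V. g j (x (Suc k) j)) - (\<Sum>j\<in>V. g j (x k j)) = (\<Sum>j\<in>V. if j = ik k then \<Delta> k else 0)"
      unfolding sum_subtractf[symmetric] using x_upd by (intro sum.cong) (auto simp: \<Delta>_def)
    then show ?case using Suc finite_V ik_V[of k] by (simp add: algebra_simps)
  qed

  define U where "U k = c0 k + (\<Sum>s<k. \<kappa> (k - s) * norm (p s))" for k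
  define Q where "Q k = c1 k + (\<Sum>s<k. \<kappa>' (k - s) * norm (\<Delta> s))" for k
  define G where "G k = (\<Sum>j\<in>V. g j (y k))" for k
  define F where "F w = (\<Sum>i\<in>V. f i w)" for w
  have U0: "0 \<le> U k" and Q0: "0 \<le> Q k" for k
    unfolding U_def Q_def using c0 c1 \<kappa> \<kappa>' by (simp_all add: sum_nonneg)
  have cons': "norm (x k j - y k) \<le> U k" if "j \<in> V" for k j using cons that unfolding U_def by blast
  have y_diff: "norm (y (Suc k) - y k) \<le> norm (p k)" for k
  proof -
    have "norm (y (Suc k) - y k) = \<bar>\<psi> k\<bar> * norm (p k)" using y by simp
    also have "\<dots> \<le> 1 * norm (p k)" using \<psi>[rule_format, of k] \<eta> by (intro mult_right_mono) auto
    finally show ?thesis by simp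
  qed
  have \<Delta>_le: "norm (\<Delta> s) \<le> Lc * (U (Suc s) + U s + norm (p s))" for s
  proof -
    let ?i = "ik s"
    have "x (Suc s) ?i - x s ?i = (x (Suc s) ?i - y (Suc s)) - (x s ?i - y s) + (y (Suc s) - y s)" by simp
    then have "norm (x (Suc s) ?i - x s ?i)
        \<le> norm (x (Suc s) ?i - y (Suc s)) + norm (x s ?i - y s) + norm (y (Suc s) - y s)"
      by (metis norm_triangle_le norm_triangle_ineq4 add_right_mono)
    also have "\<dots> \<le> U (Suc s) + U s + norm (p s)"
      using cons'[of ?i] ik_V y_diff by (intro add_mono) auto
    finally have le: "norm (x (Suc s) ?i - x s ?i) \<le> U (Suc s) + U s + norm (p s)" .
    have "norm (\<Delta> s) \<le> Lc * norm (x (Suc s) ?i - x s ?i)" unfolding \<Delta>_def by (rule lip_one) (use ik_V in auto)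
    also have "\<dots> \<le> Lc * (U (Suc s) + U s + norm (p s))" by (intro mult_left_mono le Lc)
    finally show ?thesis .
  qed
  \<comment> \<open>Passing from gradients at the scattered iterates to gradients at
    \<open>y k\<close> costs at most \<open>Lc * U k\<close>, as
    \<open>\<xi> \<le> 1\<close>.\<close>
  have split: "\<exists>\<xi>. 0 \<le> \<xi> \<and> \<xi> \<le> 1 \<and> (N \<le> k \<longrightarrow> \<eta>' \<le> \<xi>) \<and> norm (z k (ik k) - \<xi> *\<^sub>R G k) \<le> Q k + Lc * U k" for k
  proof -
    obtain \<xi> where \<xi>: "0 \<le> \<xi>" "\<xi> \<le> 1" "N \<le> k \<longrightarrow> \<eta>' \<le> \<xi>"
      and tr: "norm (z k (ik k) - \<xi> *\<^sub>R (\<Sum>j\<in>V. g j (x k j))) \<le> Q k"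
      using track ik_V[of k] unfolding total Q_def by blast
    have "norm (\<xi> *\<^sub>R ((\<Sum>j\<in>V. g j (x k j)) - G k)) \<le> 1 * (Lc * U k)"
      unfolding norm_scaleR G_def using \<xi> lip_sum[of "x k" "\<lambda>_. y k" "U k"] cons' Lc U0
      by (intro mult_mono) auto
    then have "norm ((z k (ik k) - \<xi> *\<^sub>R (\<Sum>j\<in>V. g j (x k j))) + \<xi> *\<^sub>R ((\<Sum>j\<in>V. g j (x k j)) - G k)) \<le> Q k + Lc * U k"
      using tr by (intro norm_triangle_mono) auto
    then have "norm (z k (ik k) - \<xi> *\<^sub>R G k) \<le> Q k + Lc * U k" by (simp add: scaleR_diff_right)
    then show ?thesis using \<xi> by blast
  qed
  have p_le: "norm (p k) \<le> \<gamma> k * (norm (G k) + (Q k + Lc * U k))" for k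
  proof -
    obtain \<xi> where \<xi>: "0 \<le> \<xi>" "\<xi> \<le> 1" and r: "norm (z k (ik k) - \<xi> *\<^sub>R G k) \<le> Q k + Lc * U k" using split by blast
    have "norm (z k (ik k)) \<le> norm (\<xi> *\<^sub>R G k) + norm (z k (ik k) - \<xi> *\<^sub>R G k)" by (rule norm_triangle_sub)
    moreover have "norm (\<xi> *\<^sub>R G k) \<le> norm (G k)" using \<xi> by (simp add: mult_left_le_one_le)
    ultimately have "norm (z k (ik k)) \<le> norm (G k) + (Q k + Lc * U k)" using r by linarith
    then show ?thesis unfolding p_def using \<gamma>(2)[of k] by (simp add: mult_left_mono)
  qed
  have gradF: "GDERIV F w :> (\<Sum>i\<in>V. g i w)" for w unfolding F_def using grad by (intro GDERIV_sum) blast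
  \<comment> \<open>\<open>\<psi> k\<close> is bounded below at all times, but \<open>\<xi>\<close>
    only from \<open>N\<close> on, when mass from every agent has had time to reach every other;
    hence the restriction on \<open>k\<close>.\<close>
  have descent: "F (y (Suc k)) \<le> F (y k) - \<eta> * \<eta>' * (\<gamma> k * (norm (G k))\<^sup>2)
      + \<gamma> k * (norm (G k) * (Q k + Lc * U k)) + Lc * (norm (p k))\<^sup>2" if k: "N \<le> k" for k
  proof -
    obtain \<xi> where \<xi>: "\<eta>' \<le> \<xi>" and r: "norm (z k (ik k) - \<xi> *\<^sub>R G k) \<le> Q k + Lc * U k" using split[of k] k by blast
    define r' where "r' = z k (ik k) - \<xi> *\<^sub>R G k"
    have \<psi>k: "\<eta> \<le> \<psi> k" "\<psi> k \<le> 1" using \<psi> by auto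
    have "F (y k + \<psi> k *\<^sub>R p k) \<le> F (y k) + G k \<bullet> (\<psi> k *\<^sub>R p k) + Lc * (norm (\<psi> k *\<^sub>R p k))\<^sup>2"
      unfolding G_def by (rule descent_lemma[OF gradF _ Lc]) (rule lip_sum, simp)
    moreover have "Lc * (norm (\<psi> k *\<^sub>R p k))\<^sup>2 \<le> Lc * (norm (p k))\<^sup>2"
      using y_diff[of k] y Lc by (intro mult_left_mono power_mono) auto
    moreover have "G k \<bullet> (\<psi> k *\<^sub>R p k) \<le> - (\<eta> * \<eta>' * (\<gamma> k * (norm (G k))\<^sup>2)) + \<gamma> k * (norm (G k) * (Q k + Lc * U k))"
    proof -
      have "z k (ik k) = \<xi> *\<^sub>R G k + r'" by (simp add: r'_def)
      then have eq: "G k \<bullet> (\<psi> k *\<^sub>R p k) = - (\<psi> k * \<xi> * (\<gamma> k * (norm (G k))\<^sup>2)) + \<psi> k * (\<gamma> k * - (G k \<bullet> r'))"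
        unfolding p_def by (simp add: inner_add_right power2_norm_eq_inner algebra_simps)
      have "\<eta> * \<eta>' * (\<gamma> k * (norm (G k))\<^sup>2) \<le> \<psi> k * \<xi> * (\<gamma> k * (norm (G k))\<^sup>2)"
        using \<psi>k \<xi> \<eta> \<eta>' \<gamma>(2)[of k] by (intro mult_right_mono mult_mono) auto
      moreover have "\<psi> k * (\<gamma> k * - (G k \<bullet> r')) \<le> 1 * (\<gamma> k * (norm (G k) * (Q k + Lc * U k)))"
      proof -
        have "- (G k \<bullet> r') \<le> norm (G k) * norm r'" using norm_cauchy_schwarz[of "G k" "- r'"] by simp
        also have "\<dots> \<le> norm (G k) * (Q k + Lc * U k)" using r by (intro mult_left_mono) (auto simp: r'_def)
        finally have "\<psi> k * (\<gamma> k * - (G k \<bullet> r')) \<le> \<psi> k * (\<gamma> k * (norm (G k) * (Q k + Lc * U k)))"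
          using \<psi>k \<eta> \<gamma>(2)[of k] by (intro mult_left_mono) auto
        also have "\<dots> \<le> 1 * (\<gamma> k * (norm (G k) * (Q k + Lc * U k)))"
          using \<psi>k \<gamma>(2)[of k] Q0[of k] U0[of k] Lc by (intro mult_right_mono) auto
        finally show ?thesis .
      qed
      ultimately show ?thesis using eq by linarith
    qed
    ultimately show ?thesis using y by simp
  qed
  obtain B where B: "\<And>w. B \<le> F w" using bdd unfolding F_def by blast
  have "\<exists>C. \<forall>n. (\<Sum>k<n. \<gamma> k * ((norm (G k))\<^sup>2 + (U k)\<^sup>2)) \<le> C"
  proof (rule small_gain[where \<kappa> = \<kappa> and \<kappa>' = \<kappa>' and ?c0.0 = c0 and ?c1.0 = c1 and e = "\<lambda>k. norm (p k)"
        and Q = Q and \<Delta> = "\<lambda>k. norm (\<Delta> k)" and \<Phi> = "\<lambda>k. F (y k)" and a = "\<eta> * \<eta>'" and L = Lc and K\<^sub>1 = N and B = B])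
    show "summable (\<lambda>k. (c0 k)\<^sup>2)" "summable (\<lambda>k. (c1 k)\<^sup>2)" using c0 c1 by (auto intro: summable_power2)
    show "U k \<le> c0 k + (\<Sum>s<k. \<kappa> (k - s) * norm (p s))" for k by (simp add: U_def)
    show "Q k \<le> c1 k + (\<Sum>s<k. \<kappa>' (k - s) * norm (\<Delta> s))" for k by (simp add: Q_def)
    show "0 < \<eta> * \<eta>'" using \<eta> \<eta>' by simp
  qed (use \<gamma> U0 Q0 \<kappa> \<kappa>' Lc \<Delta>_le p_le descent B in auto)
  then obtain C where C: "\<And>n. (\<Sum>k<n. \<gamma> k * ((norm (G k))\<^sup>2 + (U k)\<^sup>2)) \<le> C" by blast
  define C2 where "C2 = 2 + 2 * (\<Sum>i<I. \<bar>L i\<bar>)\<^sup>2 + 4 * real I"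
  have C2: "0 \<le> C2" unfolding C2_def by simp
  have merit: "merit I g (x k) \<le> C2 * ((norm (G k))\<^sup>2 + (U k)\<^sup>2)" for k
    unfolding C2_def G_def V_def using I_pos lip' cons' by (intro merit_le) (auto simp: V_def)
  have "(\<Sum>k<n. \<gamma> k * merit I g (x k)) \<le> C2 * C" for n
  proof -
    have "(\<Sum>k<n. \<gamma> k * merit I g (x k)) \<le> (\<Sum>k<n. \<gamma> k * (C2 * ((norm (G k))\<^sup>2 + (U k)\<^sup>2)))"
      using \<gamma>(2) merit by (intro sum_mono mult_left_mono) auto
    also have "\<dots> = C2 * (\<Sum>k<n. \<gamma> k * ((norm (G k))\<^sup>2 + (U k)\<^sup>2))" by (simp add: sum_distrib_left mult.left_commute)
    also have "\<dots> \<le> C2 * C" by (intro mult_left_mono C C2)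
    finally show ?thesis .
  qed
  then show ?thesis using first_time_le_weighted_sum[of \<gamma> "\<lambda>k. merit I g (x k)"] \<gamma>(2) unfolding \<gamma>_def by blast
qed

end
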